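(* For every channel coefficient vector $H=(h_{11},h_{12},h_{21},h_{22})\in\mathbb{C}^4$, the region $\mathbf{C}_{\rm inner}(H)$ defined below is achievable over the Gaussian interference channel with common information, i.e. $\mathbf{C}_{\rm inner}(H)\subseteq \mathbf{C}(H)$, where $\mathbf{C}(H)$ is its capacity region.
   Context: Gaussian interference channel with common information (IC-CI): two transmitters T1, T2 and two receivers R1, R2. At time $t$, $Y_1(t)=h_{11}X_1(t)+h_{12}X_2(t)+Z_1(t)$ and $Y_2(t)=h_{21}X_1(t)+h_{22}X_2(t)+Z_2(t)$, where $X_i(t)\in\mathbb{C}$ is sent by T$i$, $Y_i(t)\in\mathbb{C}$ is received by R$i$, $Z_1(t),Z_2(t)\sim\mathcal{CN}(0,1)$ are noises, i.i.d. over time and independent of the messages, and $H=(h_{11},h_{12},h_{21},h_{22})\in\mathbb{C}^4$ is deterministic and known to all terminals. An $(n,R_0,R_1,R_2,P_e^{(n)})$ code consists of: independent messages $\mathcal{M}_0,\mathcal{M}_1,\mathcal{M}_2$, with $\mathcal{M}_k$ uniform on $\{1,\dots,2^{nR_k}\}$ ($\mathcal{M}_0$ is the common message, $\mathcal{M}_i$ the individual message for receiver $i$); encoders $X_i(t)=f_i(\mathcal{M}_0,\mathcal{M}_i,t,H)$, $t=1,\dots,n$, satisfying $\frac1n\sum_{t=1}^n\mathbb{E}|X_i(t)|^2\le 1$, $i=1,2$; decoders $(\hat M_{0i},\hat M_i)=g_i(Y_i^n,H)$ at receiver $i$, where $Y_i^n=(Y_i(1),\dots,Y_i(n))$; and error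 probability $P_e^{(n)}=\Pr\{\mathcal{M}_1\ne\hat M_1\text{ or }\mathcal{M}_2\ne\hat M_2\text{ or }\mathcal{M}_0\ne\hat M_{01}\text{ or }\mathcal{M}_0\ne\hat M_{02}\}$. A triple $(R_0,R_1,R_2)$ is achievable if there is a sequence of such codes with $P_e^{(n)}\to0$ as $n\to\infty$; the capacity region $\mathbf{C}(H)$ is the closure of the set of achievable triples. Let $\mathsf{C}(P)=\log_2(1+P)$ for $P\ge0$. Define $x_{21}=\min(1,1/|h_{21}|^2)$, $x_{12}=\min(1,1/|h_{12}|^2)$ and $A_1=\mathsf{C}\!\left(\frac{|h_{11}|^2x_{21}}{1+|h_{12}|^2x_{12}}\right)$, $A_2=\mathsf{C}\!\left(\frac{|h_{22}|^2x_{12}}{1+|h_{21}|^2x_{21}}\right)$, $D_1=\mathsf{C}\!\left(\frac{|h_{11}|^2}{1+|h_{12}|^2x_{12}}\right)$, $D_2=\mathsf{C}\!\left(\frac{|h_{22}|^2}{1+|h_{21}|^2x_{21}}\right)$, $E_1=\mathsf{C}\!\left(\frac{|h_{11}|^2x_{21}+|h_{12}|^2(1-x_{12})}{1+|h_{12}|^2x_{12}}\right)$, $E_2=\mathsf{C}\!\left(\frac{|h_{22}|^2x_{12}+|h_{21}|^2(1-x_{21})}{1+|h_{21}|^2x_{21}}\right)$, $G_1=\mathsf{C}\!\left(\frac{|h_{11}|^2+|h_{12}|^2(1-x_{12})}{1+|h_{12}|^2x_{12}}\right)$, $G_2=\mathsf{C}\!\left(\frac{|h_{22}|^2+|h_{21}|^2(1-x_{21})}{1+|h_{21}|^2x_{21}}\right)$,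 $G_1'=\mathsf{C}\!\left(\frac{1+|h_{11}|^2+|h_{12}|^2}{1+|h_{12}|^2x_{12}}-1\right)$, $G_2'=\mathsf{C}\!\left(\frac{1+|h_{22}|^2+|h_{21}|^2}{1+|h_{21}|^2x_{21}}-1\right)$. $\mathbf{C}_{\rm inner}(H)$ is the set of $(R_0,R_1,R_2)$ with $R_0,R_1,R_2\ge0$ and $R_0+R_1\le G_1'$, $R_0+R_2\le G_2'$, $R_1\le D_1$, $R_2\le D_2$, $R_1+R_2\le E_1+E_2$, $R_1+R_2\le A_1+G_2$, $R_1+R_2\le A_2+G_1$, $R_0+R_1+R_2\le A_1+G_2'$, $R_0+R_1+R_2\le A_2+G_1'$, $2R_1+R_2\le A_1+G_1+E_2$, $R_1+2R_2\le A_2+G_2+E_1$, $R_0+2R_1+R_2\le A_1+G_1'+E_2$, $R_0+R_1+2R_2\le A_2+G_2'+E_1$. *)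

theory Defs
  imports "HOL-Probability.Probability"
begin

definition msgs :: "nat \<Rightarrow> real \<Rightarrow> nat set" where
  "msgs n R = {1..nat \<lceil>2 powr (real n * R)\<rceil>}"

definition CN :: "complex measure" where
  "CN = density lborel (\<lambda>z. ennreal (exp (- (cmod z)\<^sup>2) / pi))"

definition noise :: "nat \<Rightarrow> (nat \<Rightarrow> complex \<times> complex) measure" where
  "noise n = PiM {..<n} (\<lambda>_. CN \<Otimes>\<^sub>M CN)"

text \<open>Received sequences Y1^n, Y2^n given messages (m0,m1,m2) and noise realisation z.
  Encoders: f1 m0 m1 t = X1(t), f2 m0 m2 t = X2(t).\<close>
definition out1 :: "complex \<Rightarrow> complex \<Rightarrow> (nat \<Rightarrow> nat \<Rightarrow> nat \<Rightarrow> complex) \<Rightarrow>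
    (nat \<Rightarrow> nat \<Rightarrow> nat \<Rightarrow> complex) \<Rightarrow> nat \<Rightarrow> nat \<Rightarrow> nat \<Rightarrow> nat \<Rightarrow>
    (nat \<Rightarrow> complex \<times> complex) \<Rightarrow> (nat \<Rightarrow> complex)" where
  "out1 h11 h12 f1 f2 n m0 m1 m2 z =
     restrict (\<lambda>t. h11 * f1 m0 m1 t + h12 * f2 m0 m2 t + fst (z t)) {..<n}"

definition out2 :: "complex \<Rightarrow> complex \<Rightarrow> (nat \<Rightarrow> nat \<Rightarrow> nat \<Rightarrow> complex) \<Rightarrow>
    (nat \<Rightarrow> nat \<Rightarrow> nat \<Rightarrow> complex) \<Rightarrow> nat \<Rightarrow> nat \<Rightarrow> nat \<Rightarrow> nat \<Rightarrow>
    (nat \<Rightarrow> complex \<times> complex) \<Rightarrow> (nat \<Rightarrow> complex)" where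
  "out2 h21 h22 f1 f2 n m0 m1 m2 z =
     restrict (\<lambda>t. h21 * f1 m0 m1 t + h22 * f2 m0 m2 t + snd (z t)) {..<n}"

definition power_ok :: "nat \<Rightarrow> real \<Rightarrow> real \<Rightarrow> (nat \<Rightarrow> nat \<Rightarrow> nat \<Rightarrow> complex) \<Rightarrow> bool" where
  "power_ok n R0 Ri f \<longleftrightarrow>
     (1 / real n) * (\<Sum>t<n. (\<Sum>m0\<in>msgs n R0. \<Sum>mi\<in>msgs n Ri. (cmod (f m0 mi t))\<^sup>2)
                       / (real (card (msgs n R0)) * real (card (msgs n Ri)))) \<le> 1"

text \<open>An (n,R0,R1,R2) code: encoders satisfying the power constraints and (measurable)
  decoders g_i mapping Y_i^n to (estimate of M0, estimate of M_i).\<close>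
definition is_code :: "nat \<Rightarrow> real \<Rightarrow> real \<Rightarrow> real \<Rightarrow>
    (nat \<Rightarrow> nat \<Rightarrow> nat \<Rightarrow> complex) \<Rightarrow> (nat \<Rightarrow> nat \<Rightarrow> nat \<Rightarrow> complex) \<Rightarrow>
    ((nat \<Rightarrow> complex) \<Rightarrow> nat \<times> nat) \<Rightarrow> ((nat \<Rightarrow> complex) \<Rightarrow> nat \<times> nat) \<Rightarrow> bool" where
  "is_code n R0 R1 R2 f1 f2 g1 g2 \<longleftrightarrow>
     power_ok n R0 R1 f1 \<and> power_ok n R0 R2 f2 \<and>
     g1 \<in> measurable (PiM {..<n} (\<lambda>_. borel)) (count_space UNIV) \<and>
     g2 \<in> measurable (PiM {..<n} (\<lambda>_. borel)) (count_space UNIV)"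

definition err_prob :: "complex \<Rightarrow> complex \<Rightarrow> complex \<Rightarrow> complex \<Rightarrow>
    nat \<Rightarrow> real \<Rightarrow> real \<Rightarrow> real \<Rightarrow>
    (nat \<Rightarrow> nat \<Rightarrow> nat \<Rightarrow> complex) \<Rightarrow> (nat \<Rightarrow> nat \<Rightarrow> nat \<Rightarrow> complex) \<Rightarrow>
    ((nat \<Rightarrow> complex) \<Rightarrow> nat \<times> nat) \<Rightarrow> ((nat \<Rightarrow> complex) \<Rightarrow> nat \<times> nat) \<Rightarrow> real" where
  "err_prob h11 h12 h21 h22 n R0 R1 R2 f1 f2 g1 g2 =
     (\<Sum>m0\<in>msgs n R0. \<Sum>m1\<in>msgs n R1. \<Sum>m2\<in>msgs n R2.
        measure (noise n)
          {z \<in> space (noise n).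
             g1 (out1 h11 h12 f1 f2 n m0 m1 m2 z) \<noteq> (m0, m1) \<or>
             g2 (out2 h21 h22 f1 f2 n m0 m1 m2 z) \<noteq> (m0, m2)})
     / (real (card (msgs n R0)) * real (card (msgs n R1)) * real (card (msgs n R2)))"

definition achievable :: "complex \<Rightarrow> complex \<Rightarrow> complex \<Rightarrow> complex \<Rightarrow> real \<times> real \<times> real \<Rightarrow> bool" where
  "achievable h11 h12 h21 h22 r \<longleftrightarrow> (case r of (R0, R1, R2) \<Rightarrow>
     (\<exists>(f1 :: nat \<Rightarrow> nat \<Rightarrow> nat \<Rightarrow> nat \<Rightarrow> complex) (f2 :: nat \<Rightarrow> nat \<Rightarrow> nat \<Rightarrow> nat \<Rightarrow> complex)
        (g1 :: nat \<Rightarrow> (nat \<Rightarrow> complex) \<Rightarrow> nat \<times> nat) (g2 :: nat \<Rightarrow> (nat \<Rightarrow> complex) \<Rightarrow> nat \<times> nat).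
        (\<forall>n. is_code n R0 R1 R2 (f1 n) (f2 n) (g1 n) (g2 n)) \<and>
        (\<lambda>n. err_prob h11 h12 h21 h22 n R0 R1 R2 (f1 n) (f2 n) (g1 n) (g2 n)) \<longlonglongrightarrow> 0))"

definition capacity_region :: "complex \<Rightarrow> complex \<Rightarrow> complex \<Rightarrow> complex \<Rightarrow> (real \<times> real \<times> real) set" where
  "capacity_region h11 h12 h21 h22 = closure {r. achievable h11 h12 h21 h22 r}"

definition Cap :: "real \<Rightarrow> real" where
  "Cap P = log 2 (1 + P)"

text \<open>x = min(1, 1/|h|^2), with 1/0 = infinity, so x = 1 when h = 0.\<close>
definition xmin :: "complex \<Rightarrow> real" where
  "xmin h = (if (cmod h)\<^sup>2 \<le> 1 then 1 else 1 / (cmod h)\<^sup>2)"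

definition C_inner :: "complex \<Rightarrow> complex \<Rightarrow> complex \<Rightarrow> complex \<Rightarrow> (real \<times> real \<times> real) set" where
  "C_inner h11 h12 h21 h22 =
    (let a11 = (cmod h11)\<^sup>2; a12 = (cmod h12)\<^sup>2; a21 = (cmod h21)\<^sup>2; a22 = (cmod h22)\<^sup>2;
         x21 = xmin h21; x12 = xmin h12;
         A1 = Cap (a11 * x21 / (1 + a12 * x12));
         A2 = Cap (a22 * x12 / (1 + a21 * x21));
         D1 = Cap (a11 / (1 + a12 * x12));
         D2 = Cap (a22 / (1 + a21 * x21));
         E1 = Cap ((a11 * x21 + a12 * (1 - x12)) / (1 + a12 * x12));
         E2 = Cap ((a22 * x12 + a21 * (1 - x21)) / (1 + a21 * x21));
         G1 = Cap ((a11 + a12 * (1 - x12)) / (1 + a12 * x12));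
         G2 = Cap ((a22 + a21 * (1 - x21)) / (1 + a21 * x21));
         G1' = Cap ((1 + a11 + a12) / (1 + a12 * x12) - 1);
         G2' = Cap ((1 + a22 + a21) / (1 + a21 * x21) - 1)
     in {(R0, R1, R2). R0 \<ge> 0 \<and> R1 \<ge> 0 \<and> R2 \<ge> 0 \<and>
          R0 + R1 \<le> G1' \<and> R0 + R2 \<le> G2' \<and> R1 \<le> D1 \<and> R2 \<le> D2 \<and>
          R1 + R2 \<le> E1 + E2 \<and> R1 + R2 \<le> A1 + G2 \<and> R1 + R2 \<le> A2 + G1 \<and>
          R0 + R1 + R2 \<le> A1 + G2' \<and> R0 + R1 + R2 \<le> A2 + G1' \<and>
          2 * R1 + R2 \<le> A1 + G1 + E2 \<and> R1 + 2 * R2 \<le> A2 + G2 + E1 \<and>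
          R0 + 2 * R1 + R2 \<le> A1 + G1' + E2 \<and> R0 + R1 + 2 * R2 \<le> A2 + G2' + E1})"

end

theory Submission
  imports Defs
begin

text \<open>
  Both transmitters superpose a private codeword \<open>V\<^sub>i(m\<^sub>0, m\<^sub>i)\<close> on a common codeword
  \<open>W\<^sub>i(m\<^sub>0, c\<^sub>i)\<close>, where \<open>c\<^sub>i\<close> is a part of the message \<open>m\<^sub>i\<close>; all codewords are independent
  Gaussian, so the common message costs no extra power. Receiver \<open>i\<close> looks for the triple
  (\<open>m\<^sub>0\<close>, \<open>m\<^sub>i\<close>, common part of the other user) closest to the received word and treats the other
  private codeword as noise. Competing triples fall into four types, according to which common
  codewords they share with the transmitted triple; the types yield the bounds \<open>A\<close>, \<open>D\<close>, \<open>E\<close>, \<open>G\<close>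
  (note that \<open>G' = G\<close>).

  For one type with likelihoods \<open>q\<close> (true), \<open>q'\<close> (competitor) and average likelihood \<open>Q = E q'\<close>, the
  existence of a competitor with \<open>q' \<ge> q\<close> forces \<open>1 \<le> (\<theta> Q / q)\<^sup>s + \<Sum> q' / (\<theta> Q)\<close> for all \<open>\<theta>, s > 0\<close>.
  The expectations of all these terms are \<open>n\<close>-th powers of explicit Gaussian integrals, and they
  decay exponentially as soon as the rate of the type lies below its mutual information. A codeword
  that violates the power constraint is replaced by zero, which is also exponentially unlikely.

  Eliminating the private rates from these constraints gives the inner region together with the
  additional constraints \<open>R\<^sub>1 \<le> A\<^sub>1 + E\<^sub>2\<close> and \<open>R\<^sub>2 \<le> A\<^sub>2 + E\<^sub>1\<close>; where one of them fails, a different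
  power split works.
\<close>

section \<open>Complex Gaussian integrals\<close>

lemma sets_CN [simp, measurable_cong]: "sets CN = sets borel"
  by (simp add: CN_def)

lemma space_CN [simp]: "space CN = UNIV"
  by (simp add: CN_def)

lemma nn_integral_gaussian_real:
  assumes "k > 0"
  shows "(\<integral>\<^sup>+ x. ennreal (exp (- k * (x - m)\<^sup>2)) \<partial>lborel) = ennreal (sqrt (pi / k))"
proof -
  define s where "s = sqrt (1 / (2 * k))"
  have s: "s > 0" "s\<^sup>2 = 1 / (2 * k)" using assms by (auto simp: s_def)
  have "(\<integral>\<^sup>+ x. ennreal (normal_density m s x) \<partial>lborel) = 1"
    using prob_space.emeasure_space_1[OF prob_space_normal_density[OF s(1), of m]]
    by (simp add: emeasure_density)
  moreover have "exp (- k * (x - m)\<^sup>2) = sqrt (pi / k) * normal_density m s x" for x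
    using assms by (simp add: normal_density_def s field_simps)
  ultimately show ?thesis
    by (simp add: ennreal_mult' nn_integral_cmult assms less_imp_le)
qed

text \<open>The squared modulus splits into real and imaginary part, so the integral is a product of
  two real Gaussian integrals, each equal to \<open>sqrt (pi / k)\<close>.\<close>

lemma nn_integral_gaussian_complex:
  assumes "k > 0"
  shows "(\<integral>\<^sup>+ z. ennreal (exp (- k * (cmod (z - w))\<^sup>2)) \<partial>lborel) = ennreal (pi / k)"
proof -
  define f where "f b x = exp (- k * (x - w \<bullet> b)\<^sup>2)" for b :: complex and x :: real
  have "exp (- k * (cmod (z - w))\<^sup>2) = (\<Prod>b\<in>Basis. f b (z \<bullet> b))" for z
    by (simp add: f_def Basis_complex_def inner_complex_def cmod_power2 flip: exp_add)
      (simp add: algebra_simps)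
  then have "(\<integral>\<^sup>+ z. ennreal (exp (- k * (cmod (z - w))\<^sup>2)) \<partial>lborel)
     = (\<integral>\<^sup>+ z. (\<Prod>b\<in>Basis. ennreal (f b (z \<bullet> b))) \<partial>lborel)"
    by (subst prod_ennreal) (auto simp: f_def)
  also have "\<dots> = (\<Prod>b\<in>(Basis :: complex set). \<integral>\<^sup>+ x. ennreal (f b x) \<partial>lborel)"
    by (rule nn_integral_lborel_prod) (auto simp: f_def)
  also have "\<dots> = (\<Prod>b\<in>(Basis :: complex set). ennreal (sqrt (pi / k)))"
    unfolding f_def using nn_integral_gaussian_real[OF assms] by simp
  also have "\<dots> = ennreal (pi / k)"
    using assms by (simp add: Basis_complex_def flip: ennreal_mult)
  finally show ?thesis .
qed

lemma nn_integral_CN_gaussian: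
  assumes "1 + l * (cmod a)\<^sup>2 > 0"
  shows "(\<integral>\<^sup>+ g. ennreal (exp (- l * (cmod (w + a * g))\<^sup>2)) \<partial>CN)
     = ennreal (exp (- (l / (1 + l * (cmod a)\<^sup>2)) * (cmod w)\<^sup>2) / (1 + l * (cmod a)\<^sup>2))"
proof -
  define k where "k = 1 + l * (cmod a)\<^sup>2"
  define v where "v = - (complex_of_real (l / k) * cnj a * w)"
  have k: "k > 0" using assms by (simp add: k_def)
  \<comment> \<open>The point \<open>v\<close> is the centre of the completed square. Multiplying by
    \<open>k\<close> clears the denominators, after which the identity is polynomial in real and
    imaginary parts.\<close>
  have sq: "(cmod g)\<^sup>2 + l * (cmod (w + a * g))\<^sup>2 = k * (cmod (g - v))\<^sup>2 + (l / k) * (cmod w)\<^sup>2" for g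
  proof -
    have kv: "complex_of_real k * (g - v) = complex_of_real k * g + complex_of_real l * cnj a * w"
      using k by (simp add: v_def algebra_simps)
    have kA: "k = 1 + l * ((Re a)\<^sup>2 + (Im a)\<^sup>2)" by (simp add: k_def cmod_power2)
    have "k * (k * (cmod (g - v))\<^sup>2) = (cmod (complex_of_real k * (g - v)))\<^sup>2"
      using k by (simp add: norm_mult power_mult_distrib power2_eq_square)
    also have "\<dots> = (k * Re g + l * (Re a * Re w + Im a * Im w))\<^sup>2 + (k * Im g + l * (Re a * Im w - Im a * Re w))\<^sup>2"
      unfolding kv cmod_power2 by (simp add: algebra_simps)
    also have "\<dots> = k * ((cmod g)\<^sup>2 + l * (cmod (w + a * g))\<^sup>2) - l * (cmod w)\<^sup>2"
      unfolding cmod_power2 using kA by (simp add: power2_eq_square algebra_simps)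
    finally have "k * ((cmod g)\<^sup>2 + l * (cmod (w + a * g))\<^sup>2) = k * (k * (cmod (g - v))\<^sup>2 + (l / k) * (cmod w)\<^sup>2)"
      using k by (simp add: distrib_left)
    then show ?thesis using k by simp
  qed
  have "(\<integral>\<^sup>+ g. ennreal (exp (- l * (cmod (w + a * g))\<^sup>2)) \<partial>CN)
    = (\<integral>\<^sup>+ g. ennreal (exp (- (cmod g)\<^sup>2) / pi) * ennreal (exp (- l * (cmod (w + a * g))\<^sup>2)) \<partial>lborel)"
    unfolding CN_def by (subst nn_integral_density) auto
  also have "\<dots> = (\<integral>\<^sup>+ g. ennreal (exp (- (l / k) * (cmod w)\<^sup>2) / pi) * ennreal (exp (- k * (cmod (g - v))\<^sup>2)) \<partial>lborel)"
  proof (intro nn_integral_cong)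
    fix g
    have "exp (- (cmod g)\<^sup>2) * exp (- l * (cmod (w + a * g))\<^sup>2)
       = exp (- (l / k) * (cmod w)\<^sup>2) * exp (- k * (cmod (g - v))\<^sup>2)"
      using sq[of g] by (simp flip: exp_add)
    then show "ennreal (exp (- (cmod g)\<^sup>2) / pi) * ennreal (exp (- l * (cmod (w + a * g))\<^sup>2))
      = ennreal (exp (- (l / k) * (cmod w)\<^sup>2) / pi) * ennreal (exp (- k * (cmod (g - v))\<^sup>2))"
      by (simp flip: ennreal_mult)
  qed
  also have "\<dots> = ennreal (exp (- (l / k) * (cmod w)\<^sup>2) / pi) * ennreal (pi / k)"
    using nn_integral_gaussian_complex[OF k, of v] by (subst nn_integral_cmult) auto
  also have "\<dots> = ennreal (exp (- (l / k) * (cmod w)\<^sup>2) / k)"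
    using k by (simp flip: ennreal_mult)
  finally show ?thesis by (simp add: k_def)
qed

lemma prob_space_CN: "prob_space CN"
proof
  show "emeasure CN (space CN) = 1"
    \<comment> \<open>For \<open>l = 0\<close> the integrand is the constant 1.\<close>
    using nn_integral_CN_gaussian[of 0 1 0] by (simp add: nn_integral_const)
qed

interpretation CN: prob_space CN by (rule prob_space_CN)

lemma emeasure_CN_UNIV [simp]: "emeasure CN UNIV = 1"
  using CN.emeasure_space_1 by simp

section \<open>Integrals over families of independent Gaussians\<close>

text \<open>By Fubini, redrawing coordinate \<open>i\<close> independently does not change the
  integral. One coordinate can thus be integrated out first while the index set \<open>J\<close>
  stays fixed.\<close>

lemma nn_integral_PiM_resample:
  assumes M: "\<And>i. prob_space (M i)" and J: "finite J" "i \<in> J"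
    and f [measurable]: "f \<in> borel_measurable (PiM J M)"
  shows "(\<integral>\<^sup>+ x. f x \<partial>PiM J M) = (\<integral>\<^sup>+ x. (\<integral>\<^sup>+ y. f (x(i := y)) \<partial>M i) \<partial>PiM J M)"
proof -
  interpret Mi: prob_space "M i" by (rule M)
  interpret product_prob_space M
    by (intro product_prob_spaceI M)
  define I where "I = J - {i}"
  have I: "finite I" "i \<notin> I" and JI: "J = insert i I"
    using J by (auto simp: I_def)
  have f' [measurable]: "f \<in> borel_measurable (PiM (insert i I) M)" using f JI by simp
  have upd: "(\<lambda>p. (fst p)(i := snd p)) \<in> measurable (PiM (insert i I) M \<Otimes>\<^sub>M M i) (PiM (insert i I) M)"
    by (rule measurable_fun_upd[where J = "insert i I"]) auto
  have "(\<lambda>p. f ((fst p)(i := snd p))) \<in> borel_measurable (PiM (insert i I) M \<Otimes>\<^sub>M M i)"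
    using measurable_compose[OF upd f'] by simp
  then have m: "(\<lambda>x. \<integral>\<^sup>+ y. f (x(i := y)) \<partial>M i) \<in> borel_measurable (PiM (insert i I) M)"
    by (intro Mi.borel_measurable_nn_integral) (simp add: split_beta')
  show ?thesis
    unfolding JI
    by (simp add: product_nn_integral_insert[OF I m] product_nn_integral_insert[OF I f']
        Mi.emeasure_space_1)
qed

text \<open>A sum of independent Gaussians is Gaussian, and its variance is the sum of the
  variances. Integrating out one coordinate of variance \<open>p\<close> replaces \<open>l\<close>
  by \<open>l / (1 + l * p)\<close> and contributes the factor \<open>1 / (1 + l * p)\<close>;
  composing these maps only involves the total variance. \<open>F\<close> and \<open>w\<close> carry
  whatever is independent of the coordinates in \<open>K\<close>.\<close>

lemma nn_integral_PiM_CN_gaussian: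
  fixes a :: "'j \<Rightarrow> complex"
  assumes J: "finite J" and "K \<subseteq> J" and "1 + l * (\<Sum>j\<in>K. (cmod (a j))\<^sup>2) > 0"
    and F [measurable]: "F \<in> borel_measurable (PiM J (\<lambda>_. CN))"
    and w [measurable]: "w \<in> borel_measurable (PiM J (\<lambda>_. CN))"
    and "\<And>c j y. j \<in> K \<Longrightarrow> F (c(j := y)) = F c" and "\<And>c j y. j \<in> K \<Longrightarrow> w (c(j := y)) = w c"
  shows "(\<integral>\<^sup>+ c. F c * ennreal (exp (- l * (cmod (w c + (\<Sum>j\<in>K. a j * c j)))\<^sup>2)) \<partial>PiM J (\<lambda>_. CN))
    = (\<integral>\<^sup>+ c. F c * ennreal (exp (- (l / (1 + l * (\<Sum>j\<in>K. (cmod (a j))\<^sup>2))) * (cmod (w c))\<^sup>2)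
          / (1 + l * (\<Sum>j\<in>K. (cmod (a j))\<^sup>2))) \<partial>PiM J (\<lambda>_. CN))"
proof -
  have "finite K" using assms(1,2) finite_subset by blast
  then show ?thesis using assms(2,3,6,7)
  proof (induction K arbitrary: l rule: finite_induct)
    case empty
    then show ?case by simp
  next
    case (insert i K)
    define P where "P = (\<Sum>j\<in>K. (cmod (a j))\<^sup>2)"
    define p where "p = (cmod (a i))\<^sup>2"
    have sumP: "(\<Sum>j\<in>insert i K. (cmod (a j))\<^sup>2) = p + P"
      using insert.hyps by (simp add: P_def p_def)
    have P: "P \<ge> 0" "p \<ge> 0" by (auto simp: P_def p_def sum_nonneg)
    have pos: "1 + l * (p + P) > 0" using insert.prems(2) sumP by simp
    \<comment> \<open>For negative \<open>l\<close> the denominator of a partial sum is at least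
      that of the full sum.\<close>
    have pos1: "1 + l * p > 0"
    proof (cases "l \<ge> 0")
      case True then show ?thesis using P by (simp add: add_pos_nonneg)
    next
      case False
      then have "l * P \<le> 0" using P by (simp add: mult_nonpos_nonneg)
      then show ?thesis using pos by (simp add: distrib_left)
    qed
    define l' where "l' = l / (1 + l * p)"
    have l'P: "1 + l' * P = (1 + l * (p + P)) / (1 + l * p)"
      using pos1 by (simp add: l'_def field_simps)
    then have pos2: "1 + l' * P > 0" using pos pos1 by simp
    have comp [measurable]: "(\<lambda>c. c j) \<in> borel_measurable (PiM J (\<lambda>_. CN))" if "j \<in> insert i K" for j
      using measurable_component_singleton[of j J "\<lambda>_. CN"] that insert.prems(1)
      by (auto simp: measurable_cong_sets[OF refl sets_CN])
    have S [measurable]: "(\<lambda>c. \<Sum>j\<in>insert i K. a j * c j) \<in> borel_measurable (PiM J (\<lambda>_. CN))"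
      "(\<lambda>c. \<Sum>j\<in>K. a j * c j) \<in> borel_measurable (PiM J (\<lambda>_. CN))"
      by (auto intro!: borel_measurable_sum borel_measurable_times)
    have "(\<integral>\<^sup>+ c. F c * ennreal (exp (- l * (cmod (w c + (\<Sum>j\<in>insert i K. a j * c j)))\<^sup>2)) \<partial>PiM J (\<lambda>_. CN))
       = (\<integral>\<^sup>+ c. (\<integral>\<^sup>+ g. F (c(i := g)) * ennreal (exp (- l * (cmod (w (c(i := g)) +
             (\<Sum>j\<in>insert i K. a j * (c(i := g)) j)))\<^sup>2)) \<partial>CN) \<partial>PiM J (\<lambda>_. CN))"
      using insert.prems(1) by (intro nn_integral_PiM_resample prob_space_CN J) auto
    also have "\<dots> = (\<integral>\<^sup>+ c. ennreal (1 / (1 + l * p)) * (F c * ennreal (exp (- l' * (cmod (w c + (\<Sum>j\<in>K. a j * c j)))\<^sup>2)))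
        \<partial>PiM J (\<lambda>_. CN))"
    proof (intro nn_integral_cong)
      fix c
      have eq: "w (c(i := g)) + (\<Sum>j\<in>insert i K. a j * (c(i := g)) j)
          = (w c + (\<Sum>j\<in>K. a j * c j)) + a i * g" for g
      proof -
        have "(\<Sum>j\<in>K. a j * (c(i := g)) j) = (\<Sum>j\<in>K. a j * c j)"
          using insert.hyps by (intro sum.cong) auto
        then show ?thesis
          using insert.hyps insert.prems(4) by (simp del: fun_upd_apply) simp
      qed
      have "(\<integral>\<^sup>+ g. F (c(i := g)) * ennreal (exp (- l * (cmod (w (c(i := g)) +
             (\<Sum>j\<in>insert i K. a j * (c(i := g)) j)))\<^sup>2)) \<partial>CN)
        = F c * (\<integral>\<^sup>+ g. ennreal (exp (- l * (cmod ((w c + (\<Sum>j\<in>K. a j * c j)) + a i * g))\<^sup>2)) \<partial>CN)"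
      proof -
        have [simp]: "F (c(i := g)) = F c" for g by (rule insert.prems(3)) simp
        show ?thesis unfolding eq
          by (subst nn_integral_cmult[symmetric])
            (simp_all del: fun_upd_apply add: measurable_cong_sets[OF sets_CN refl])
      qed
      also have "\<dots> = F c * ennreal (exp (- l' * (cmod (w c + (\<Sum>j\<in>K. a j * c j)))\<^sup>2) / (1 + l * p))"
        using nn_integral_CN_gaussian[of l "a i" "w c + (\<Sum>j\<in>K. a j * c j)"] pos1
        by (simp add: p_def l'_def)
      also have "\<dots> = ennreal (1 / (1 + l * p)) * (F c * ennreal (exp (- l' * (cmod (w c + (\<Sum>j\<in>K. a j * c j)))\<^sup>2)))"
        using pos1 by (subst mult.left_commute, subst ennreal_mult[symmetric]) auto
      finally show "(\<integral>\<^sup>+ g. F (c(i := g)) * ennreal (exp (- l * (cmod (w (c(i := g)) +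
             (\<Sum>j\<in>insert i K. a j * (c(i := g)) j)))\<^sup>2)) \<partial>CN) = \<dots>" .
    qed
    also have "\<dots> = ennreal (1 / (1 + l * p)) *
       (\<integral>\<^sup>+ c. F c * ennreal (exp (- l' * (cmod (w c + (\<Sum>j\<in>K. a j * c j)))\<^sup>2)) \<partial>PiM J (\<lambda>_. CN))"
      by (rule nn_integral_cmult) measurable
    also have "\<dots> = ennreal (1 / (1 + l * p)) *
       (\<integral>\<^sup>+ c. F c * ennreal (exp (- (l' / (1 + l' * P)) * (cmod (w c))\<^sup>2) / (1 + l' * P)) \<partial>PiM J (\<lambda>_. CN))"
      using insert.IH[of l'] insert.prems pos2 by (simp add: P_def)
    also have "\<dots> = (\<integral>\<^sup>+ c. ennreal (1 / (1 + l * p)) * (F c * ennreal (exp (- (l' / (1 + l' * P)) * (cmod (w c))\<^sup>2) / (1 + l' * P))) \<partial>PiM J (\<lambda>_. CN))"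
      by (rule nn_integral_cmult[symmetric]) measurable
    also have "\<dots> = (\<integral>\<^sup>+ c. F c * ennreal (exp (- (l / (1 + l * (p + P))) * (cmod (w c))\<^sup>2) / (1 + l * (p + P))) \<partial>PiM J (\<lambda>_. CN))"
    proof (intro nn_integral_cong)
      fix c
      have "l' / (1 + l' * P) = l / (1 + l * (p + P))"
        unfolding l'P using pos1 by (simp add: l'_def)
      moreover have "(1 + l * p) * (1 + l' * P) = 1 + l * (p + P)"
        unfolding l'P using pos1 by simp
      ultimately show "ennreal (1 / (1 + l * p)) * (F c * ennreal (exp (- (l' / (1 + l' * P)) * (cmod (w c))\<^sup>2) / (1 + l' * P)))
        = F c * ennreal (exp (- (l / (1 + l * (p + P))) * (cmod (w c))\<^sup>2) / (1 + l * (p + P)))"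
        using pos1 pos2 by (subst mult.left_commute, subst ennreal_mult[symmetric]) auto
    qed
    finally show ?case by (simp add: sumP)
  qed
qed

text \<open>Independence over time reduces an integral of a product over letters to the power of a
  single-letter integral. Fubini puts \<open>M\<close> innermost, so that later the codebook letters
  are integrated for fixed noise.\<close>

lemma nn_integral_iterated_prod:
  assumes M: "prob_space M" and N: "prob_space N" and I: "finite I"
    and F [measurable]: "(\<lambda>p. F (fst p) (snd p)) \<in> borel_measurable (M \<Otimes>\<^sub>M N)"
  shows "(\<integral>\<^sup>+ c. \<integral>\<^sup>+ z. (\<Prod>t\<in>I. F (c t) (z t)) \<partial>PiM I (\<lambda>_. N) \<partial>PiM I (\<lambda>_. M))
     = (\<integral>\<^sup>+ y. \<integral>\<^sup>+ x. F x y \<partial>M \<partial>N) ^ card I"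
proof -
  interpret M: prob_space M by (rule M)
  interpret N: prob_space N by (rule N)
  interpret PM: product_prob_space "\<lambda>_. M" by (intro product_prob_spaceI M)
  interpret PN: product_prob_space "\<lambda>_. N" by (intro product_prob_spaceI N)
  have "(\<integral>\<^sup>+ z. (\<Prod>t\<in>I. F (c t) (z t)) \<partial>PiM I (\<lambda>_. N)) = (\<Prod>t\<in>I. \<integral>\<^sup>+ y. F (c t) y \<partial>N)"
    if c: "c \<in> space (PiM I (\<lambda>_. M))" for c
  proof (rule PN.product_nn_integral_prod[OF I, where f = "\<lambda>t. F (c t)"])
    fix t assume "t \<in> I"
    then have "c t \<in> space M" using c by (auto simp: space_PiM)
    then show "F (c t) \<in> borel_measurable N"
      using measurable_compose[OF measurable_Pair1' F] by simp
  qed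
  then have "(\<integral>\<^sup>+ c. \<integral>\<^sup>+ z. (\<Prod>t\<in>I. F (c t) (z t)) \<partial>PiM I (\<lambda>_. N) \<partial>PiM I (\<lambda>_. M))
     = (\<integral>\<^sup>+ c. (\<Prod>t\<in>I. \<integral>\<^sup>+ y. F (c t) y \<partial>N) \<partial>PiM I (\<lambda>_. M))"
    by (intro nn_integral_cong) auto
  also have "\<dots> = (\<Prod>t\<in>I. \<integral>\<^sup>+ x. \<integral>\<^sup>+ y. F x y \<partial>N \<partial>M)"
    using F by (intro PM.product_nn_integral_prod I N.borel_measurable_nn_integral) (simp add: split_beta')
  also have "(\<integral>\<^sup>+ x. \<integral>\<^sup>+ y. F x y \<partial>N \<partial>M) = (\<integral>\<^sup>+ y. \<integral>\<^sup>+ x. F x y \<partial>M \<partial>N)"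
    using F by (intro pair_sigma_finite.Fubini'[symmetric])
      (auto simp: pair_sigma_finite_def split_beta' M.sigma_finite_measure_axioms N.sigma_finite_measure_axioms)
  finally show ?thesis by simp
qed

lemma prob_space_CN_pair: "prob_space (CN \<Otimes>\<^sub>M CN)"
  by (intro prob_space_pair prob_space_CN)

lemma prob_space_PiM_CN: "prob_space (PiM J (\<lambda>_. CN))"
  by (intro prob_space_PiM prob_space_CN)

lemma prob_space_noise: "prob_space (noise n)"
  unfolding noise_def by (intro prob_space_PiM prob_space_CN_pair)

lemma nn_integral_CN_pair_component:
  assumes pr: "pr \<in> {fst, snd}" and [measurable]: "f \<in> borel_measurable borel"
  shows "(\<integral>\<^sup>+ z. f (pr z) \<partial>(CN \<Otimes>\<^sub>M CN)) = (\<integral>\<^sup>+ z. f z \<partial>CN)"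
proof -
  have "(\<integral>\<^sup>+ z. f (fst z) \<partial>(CN \<Otimes>\<^sub>M CN)) = (\<integral>\<^sup>+ z. f z \<partial>CN)"
    by (subst CN.nn_integral_fst[symmetric]) (auto simp: CN.emeasure_space_1)
  moreover have "(\<integral>\<^sup>+ z. f (snd z) \<partial>(CN \<Otimes>\<^sub>M CN)) = (\<integral>\<^sup>+ z. f z \<partial>CN)"
    by (subst CN.nn_integral_fst[symmetric]) (auto simp: CN.emeasure_space_1)
  ultimately show ?thesis using pr by auto
qed

lemma measurable_component_PiM_CN:
  assumes "j \<in> J"
  shows "(\<lambda>c. c j) \<in> borel_measurable (PiM J (\<lambda>_. CN))"
  using measurable_component_singleton[of j J "\<lambda>_. CN"] assms
  by (auto simp: measurable_cong_sets[OF refl sets_CN])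

lemma measurable_linear_PiM_CN:
  assumes "K \<subseteq> J"
  shows "(\<lambda>c. \<Sum>j\<in>K. a j * c j) \<in> borel_measurable (PiM J (\<lambda>_. CN))"
  using assms
  by (intro borel_measurable_sum borel_measurable_times borel_measurable_const measurable_component_PiM_CN) auto

text \<open>This is the expectation of \<open>(Q / q)\<close> to the power \<open>s\<close> for one
  letter, up to normalisation: \<open>b * c q + pr z\<close> is the effective noise of variance
  \<open>N\<close>, and the true codewords in \<open>U\<close> add power \<open>P\<close>. Three
  Gaussian integrations in turn remove \<open>U\<close>, the interfering letter \<open>q\<close> and
  the channel noise. The result differs from 1 only to second order in \<open>s\<close>.\<close>

lemma nn_integral_tilted_density:
  fixes a :: "'j \<Rightarrow> complex"
  assumes J: "finite J" "U \<subseteq> J" "q \<in> J" "q \<notin> U" and pr: "pr \<in> {fst, snd}"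
    and s: "0 < s" "s < 1"
    and N: "N = 1 + (cmod b)\<^sup>2" and P: "P = (\<Sum>j\<in>U. (cmod (a j))\<^sup>2)"
  shows "(\<integral>\<^sup>+ z. \<integral>\<^sup>+ c. ennreal (exp (s * ((cmod (b * c q + pr z))\<^sup>2 / N
            - (cmod (b * c q + pr z + (\<Sum>j\<in>U. a j * c j)))\<^sup>2 / (N + P)))) \<partial>PiM J (\<lambda>_. CN) \<partial>(CN \<Otimes>\<^sub>M CN))
     = ennreal (1 / (1 - s\<^sup>2 * P / (N + P)))"
proof -
  interpret PJ: prob_space "PiM J (\<lambda>_. CN)" by (rule prob_space_PiM_CN)
  note [measurable] = measurable_component_PiM_CN[OF J(3)]
  have N1: "N \<ge> 1" and P0: "P \<ge> 0" using N P by (auto simp: sum_nonneg)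
  define l where "l = s / (N + P)"
  have l: "l > 0" and lP: "1 + l * P > 0"
    using s N1 P0 by (auto simp: l_def intro!: add_pos_nonneg divide_nonneg_nonneg)
  \<comment> \<open>This is the negated coefficient of the squared modulus of the effective noise
    once \<open>U\<close> is integrated out. It is never positive, so the positivity of the next
    denominators has to be checked.\<close>
  define l2 where "l2 = l / (1 + l * P) - s / N"
  \<comment> \<open>The product of all denominators, with interference and noise combined into
    variance \<open>N\<close>; it simplifies because \<open>l * N = s - l * P\<close>.\<close>
  have prod: "(1 + l * P) * (1 + l2 * N) = 1 - s\<^sup>2 * P / (N + P)"
  proof -
    have "(1 + l * P) * (1 + l2 * N) = (1 + l * P) * (1 - s) + l * N"
    proof -
      have "l2 * N = l * N / (1 + l * P) - s" using N1 by (simp add: l2_def left_diff_distrib)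
      then have "1 + l2 * N = (1 - s) + l * N / (1 + l * P)" by simp
      then show ?thesis using lP by (simp only: distrib_left) simp
    qed
    also have "\<dots> = 1 - s\<^sup>2 * P / (N + P)"
    proof -
      have "l * N = s - l * P" using N1 P0 by (simp add: l_def field_simps)
      moreover have "s\<^sup>2 * P / (N + P) = s * (l * P)" by (simp add: l_def power2_eq_square)
      ultimately show ?thesis by (simp add: algebra_simps)
    qed
    finally show ?thesis .
  qed
  have "s\<^sup>2 * P < N + P"
  proof -
    have "s\<^sup>2 \<le> 1" using s by (simp add: power_le_one)
    then have "s\<^sup>2 * P \<le> 1 * P" using P0 by (intro mult_right_mono) auto
    then show ?thesis using N1 by simp
  qed
  then have prod_pos: "1 - s\<^sup>2 * P / (N + P) > 0" using N1 P0 by simp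
  have l2N: "1 + l2 * N > 0" using prod prod_pos lP by (metis zero_less_mult_pos)
  have l2b: "1 + l2 * (cmod b)\<^sup>2 > 0"
  proof (cases "l2 \<ge> 0")
    case True then show ?thesis by (simp add: add_pos_nonneg)
  next
    case False then show ?thesis using l2N by (simp add: N distrib_left)
  qed
  define l3 where "l3 = l2 / (1 + l2 * (cmod b)\<^sup>2)"
  have l3: "(1 + l2 * (cmod b)\<^sup>2) * (1 + l3) = 1 + l2 * N"
    using l2b by (simp add: l3_def N field_simps)
  then have l3pos: "1 + l3 > 0" using l2N l2b by (metis zero_less_mult_pos)
  have inner: "(\<integral>\<^sup>+ c. ennreal (exp (s * ((cmod (b * c q + y))\<^sup>2 / N
            - (cmod (b * c q + y + (\<Sum>j\<in>U. a j * c j)))\<^sup>2 / (N + P)))) \<partial>PiM J (\<lambda>_. CN))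
     = ennreal (exp (- l3 * (cmod (0 + 1 * y))\<^sup>2) / ((1 + l * P) * (1 + l2 * (cmod b)\<^sup>2)))" for y
  proof -
    have "(\<integral>\<^sup>+ c. ennreal (exp (s * ((cmod (b * c q + y))\<^sup>2 / N
            - (cmod (b * c q + y + (\<Sum>j\<in>U. a j * c j)))\<^sup>2 / (N + P)))) \<partial>PiM J (\<lambda>_. CN))
      = (\<integral>\<^sup>+ c. ennreal (exp (s / N * (cmod (b * c q + y))\<^sup>2)) *
           ennreal (exp (- l * (cmod ((b * c q + y) + (\<Sum>j\<in>U. a j * c j)))\<^sup>2)) \<partial>PiM J (\<lambda>_. CN))"
      by (intro nn_integral_cong)
        (simp add: l_def algebra_simps flip: ennreal_mult exp_add)
    also have "\<dots> = (\<integral>\<^sup>+ c. ennreal (exp (s / N * (cmod (b * c q + y))\<^sup>2)) *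
         ennreal (exp (- (l / (1 + l * P)) * (cmod (b * c q + y))\<^sup>2) / (1 + l * P)) \<partial>PiM J (\<lambda>_. CN))"
      by (rule nn_integral_PiM_CN_gaussian[OF J(1,2), of l a
            "\<lambda>c. ennreal (exp (s / N * (cmod (b * c q + y))\<^sup>2))" "\<lambda>c. b * c q + y", folded P])
        (use lP J in auto)
    also have "\<dots> = (\<integral>\<^sup>+ c. ennreal (1 / (1 + l * P)) *
         ennreal (exp (- l2 * (cmod (y + (\<Sum>j\<in>{q}. b * c j)))\<^sup>2)) \<partial>PiM J (\<lambda>_. CN))"
    proof (intro nn_integral_cong)
      fix c
      have "exp (s / N * (cmod (b * c q + y))\<^sup>2) * exp (- (l / (1 + l * P)) * (cmod (b * c q + y))\<^sup>2)
        = exp (- l2 * (cmod (y + (\<Sum>j\<in>{q}. b * c j)))\<^sup>2)"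
        by (simp add: l2_def add.commute flip: exp_add) (simp add: algebra_simps)
      then show "ennreal (exp (s / N * (cmod (b * c q + y))\<^sup>2)) *
         ennreal (exp (- (l / (1 + l * P)) * (cmod (b * c q + y))\<^sup>2) / (1 + l * P))
         = ennreal (1 / (1 + l * P)) * ennreal (exp (- l2 * (cmod (y + (\<Sum>j\<in>{q}. b * c j)))\<^sup>2))"
        using lP by (simp flip: ennreal_mult)
    qed
    also have "\<dots> = (\<integral>\<^sup>+ c. ennreal (1 / (1 + l * P)) * ennreal (exp (- (l2 / (1 + l2 * (\<Sum>j\<in>{q}. (cmod b)\<^sup>2))) * (cmod y)\<^sup>2)
          / (1 + l2 * (\<Sum>j\<in>{q}. (cmod b)\<^sup>2))) \<partial>PiM J (\<lambda>_. CN))"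
      by (rule nn_integral_PiM_CN_gaussian[OF J(1), of "{q}" l2 "\<lambda>_. b" "\<lambda>_. ennreal (1 / (1 + l * P))" "\<lambda>_. y"])
        (use l2b J in auto)
    also have "\<dots> = ennreal (exp (- l3 * (cmod (0 + 1 * y))\<^sup>2) / ((1 + l * P) * (1 + l2 * (cmod b)\<^sup>2)))"
      using lP l2b by (simp add: PJ.emeasure_space_1 l3_def flip: ennreal_mult)
    finally show ?thesis .
  qed
  have "(\<integral>\<^sup>+ z. ennreal (exp (- l3 * (cmod (0 + 1 * pr z))\<^sup>2) / ((1 + l * P) * (1 + l2 * (cmod b)\<^sup>2))) \<partial>(CN \<Otimes>\<^sub>M CN))
    = (\<integral>\<^sup>+ z. ennreal (exp (- l3 * (cmod (0 + 1 * z))\<^sup>2) / ((1 + l * P) * (1 + l2 * (cmod b)\<^sup>2))) \<partial>CN)"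
    by (rule nn_integral_CN_pair_component[OF pr]) measurable
  also have "\<dots> = (\<integral>\<^sup>+ z. ennreal (1 / ((1 + l * P) * (1 + l2 * (cmod b)\<^sup>2))) * ennreal (exp (- l3 * (cmod (0 + 1 * z))\<^sup>2)) \<partial>CN)"
    using lP l2b by (intro nn_integral_cong) (simp flip: ennreal_mult)
  also have "\<dots> = ennreal (1 / ((1 + l * P) * (1 + l2 * (cmod b)\<^sup>2))) * ennreal (1 / (1 + l3))"
    using nn_integral_CN_gaussian[of l3 1 0] l3pos
    by (subst nn_integral_cmult) (auto simp: measurable_cong_sets[OF sets_CN refl])
  also have "\<dots> = ennreal (1 / ((1 + l * P) * ((1 + l2 * (cmod b)\<^sup>2) * (1 + l3))))"
    using lP l2b l3pos by (simp add: mult.assoc flip: ennreal_mult)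
  finally show ?thesis unfolding l3 prod inner .
qed

text \<open>The expectation of \<open>q' / Q\<close> for one letter, up to normalisation. The
  hypothesis \<open>inv\<close> expresses that the received letter \<open>y\<close> is independent
  of the competing codewords \<open>V\<close>. Averaging the competitor's likelihood over
  \<open>V\<close> produces exactly the inverse of the first exponential, so the value does not
  depend on \<open>y\<close>.\<close>

lemma nn_integral_competitor_ratio:
  fixes a :: "'j \<Rightarrow> complex"
  assumes J: "finite J" "V \<subseteq> J" and N: "N > 0" and P: "P = (\<Sum>j\<in>V. (cmod (a j))\<^sup>2)"
    and y: "\<And>z. (\<lambda>c. y c z) \<in> borel_measurable (PiM J (\<lambda>_. CN))"
    and inv: "\<And>c z j g. j \<in> V \<Longrightarrow> y (c(j := g)) z = y c z"
  shows "(\<integral>\<^sup>+ z. \<integral>\<^sup>+ c. ennreal (exp ((cmod (y c z))\<^sup>2 / (N + P)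
            - (cmod (y c z - (\<Sum>j\<in>V. a j * c j)))\<^sup>2 / N)) \<partial>PiM J (\<lambda>_. CN) \<partial>(CN \<Otimes>\<^sub>M CN))
     = ennreal (N / (N + P))"
proof -
  interpret PJ: prob_space "PiM J (\<lambda>_. CN)" by (rule prob_space_PiM_CN)
  interpret PZ: prob_space "CN \<Otimes>\<^sub>M CN" by (rule prob_space_CN_pair)
  have P0: "P \<ge> 0" using P by (auto simp: sum_nonneg)
  have "(\<integral>\<^sup>+ c. ennreal (exp ((cmod (y c z))\<^sup>2 / (N + P)
            - (cmod (y c z - (\<Sum>j\<in>V. a j * c j)))\<^sup>2 / N)) \<partial>PiM J (\<lambda>_. CN)) = ennreal (N / (N + P))" for z
  proof -
    note y[of z, measurable]
    have Pa: "P = (\<Sum>j\<in>V. (cmod (- a j))\<^sup>2)" by (simp add: P)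
    have pos: "1 + 1 / N * P > 0" using N P0 by (simp add: add_pos_nonneg)
    have "(\<integral>\<^sup>+ c. ennreal (exp ((cmod (y c z))\<^sup>2 / (N + P)
            - (cmod (y c z - (\<Sum>j\<in>V. a j * c j)))\<^sup>2 / N)) \<partial>PiM J (\<lambda>_. CN))
      = (\<integral>\<^sup>+ c. ennreal (exp ((cmod (y c z))\<^sup>2 / (N + P))) *
          ennreal (exp (- (1 / N) * (cmod (y c z + (\<Sum>j\<in>V. - a j * c j)))\<^sup>2)) \<partial>PiM J (\<lambda>_. CN))"
      by (intro nn_integral_cong) (simp add: sum_negf flip: ennreal_mult exp_add)
    also have "\<dots> = (\<integral>\<^sup>+ c. ennreal (exp ((cmod (y c z))\<^sup>2 / (N + P))) *
          ennreal (exp (- (1 / N / (1 + 1 / N * P)) * (cmod (y c z))\<^sup>2) / (1 + 1 / N * P)) \<partial>PiM J (\<lambda>_. CN))"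
      unfolding Pa
    proof (rule nn_integral_PiM_CN_gaussian[OF J])
      show "0 < 1 + 1 / N * (\<Sum>j\<in>V. (cmod (- a j))\<^sup>2)" using pos unfolding Pa .
      show "(\<lambda>c. y c z) \<in> borel_measurable (PiM J (\<lambda>_. CN))" by (rule y)
      show "(\<lambda>c. ennreal (exp ((cmod (y c z))\<^sup>2 / (N + (\<Sum>j\<in>V. (cmod (- a j))\<^sup>2))))) \<in> borel_measurable (PiM J (\<lambda>_. CN))"
        by (rule measurable_compose[OF y]) measurable
    qed (simp_all only: inv)
    also have "\<dots> = (\<integral>\<^sup>+ c. ennreal (N / (N + P)) \<partial>PiM J (\<lambda>_. CN))"
    proof (intro nn_integral_cong)
      fix c
      define k where "k = 1 / N / (1 + 1 / N * P)"
      have "N * (1 + 1 / N * P) = N + P" using N by (simp add: distrib_left)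
      then have k: "k = 1 / (N + P)" and D: "1 / (1 + 1 / N * P) = N / (N + P)"
        using N P0 pos by (simp_all add: k_def) (simp add: frac_eq_eq)
      have "exp ((cmod (y c z))\<^sup>2 / (N + P)) * exp (- k * (cmod (y c z))\<^sup>2) = 1"
        by (simp add: k flip: exp_add)
      then have "exp ((cmod (y c z))\<^sup>2 / (N + P)) * (exp (- k * (cmod (y c z))\<^sup>2) / (1 + 1 / N * P))
         = N / (N + P)"
        by (simp only: times_divide_eq_right D)
      then show "ennreal (exp ((cmod (y c z))\<^sup>2 / (N + P))) *
          ennreal (exp (- (1 / N / (1 + 1 / N * P)) * (cmod (y c z))\<^sup>2) / (1 + 1 / N * P)) = ennreal (N / (N + P))"
        using pos unfolding k_def[symmetric] by (subst ennreal_mult[symmetric]) auto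
    qed
    finally show ?thesis by (simp add: PJ.emeasure_space_1)
  qed
  then show ?thesis by (simp add: PZ.emeasure_space_1)
qed

section \<open>Random codebooks and minimum distance decoding\<close>

text \<open>Joint law of codebook and noise. Time is the outer index of both factors and
  \<open>J\<close> indexes the codewords, so that integrals of letterwise products
  factorise.\<close>

definition code_noise :: "nat \<Rightarrow> 'j set \<Rightarrow> ((nat \<Rightarrow> 'j \<Rightarrow> complex) \<times> (nat \<Rightarrow> complex \<times> complex)) measure" where
  "code_noise n J = PiM {..<n} (\<lambda>_. PiM J (\<lambda>_. CN)) \<Otimes>\<^sub>M noise n"

lemma prob_space_code: "prob_space (PiM I (\<lambda>_. PiM J (\<lambda>_. CN)))"
  by (intro prob_space_PiM prob_space_PiM_CN)

lemma measurable_letter_pair: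
  assumes "t < n"
  shows "(\<lambda>p. (fst p t, snd p t)) \<in> measurable (code_noise n J) (PiM J (\<lambda>_. CN) \<Otimes>\<^sub>M (CN \<Otimes>\<^sub>M CN))"
proof -
  have [measurable]: "t \<in> {..<n}" using assms by simp
  show ?thesis unfolding code_noise_def noise_def by measurable
qed

lemma nn_integral_code_noise_prod:
  assumes F: "(\<lambda>p. F (fst p) (snd p)) \<in> borel_measurable (PiM J (\<lambda>_. CN) \<Otimes>\<^sub>M (CN \<Otimes>\<^sub>M CN))"
  shows "(\<integral>\<^sup>+ p. (\<Prod>t<n. F (fst p t) (snd p t)) \<partial>code_noise n J)
     = (\<integral>\<^sup>+ z. \<integral>\<^sup>+ c. F c z \<partial>PiM J (\<lambda>_. CN) \<partial>(CN \<Otimes>\<^sub>M CN)) ^ n"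
proof -
  interpret Z: prob_space "noise n" by (rule prob_space_noise)
  have "(\<lambda>p. F (fst p t) (snd p t)) \<in> borel_measurable (code_noise n J)" if "t < n" for t
    using measurable_compose[OF measurable_letter_pair[OF that] F] by simp
  then have "(\<lambda>p. \<Prod>t<n. F (fst p t) (snd p t)) \<in> borel_measurable (code_noise n J)"
    by (intro borel_measurable_prod_ennreal) auto
  then have "(\<integral>\<^sup>+ p. (\<Prod>t<n. F (fst p t) (snd p t)) \<partial>code_noise n J)
     = (\<integral>\<^sup>+ c. \<integral>\<^sup>+ z. (\<Prod>t<n. F (c t) (z t)) \<partial>noise n \<partial>PiM {..<n} (\<lambda>_. PiM J (\<lambda>_. CN)))"
    unfolding code_noise_def by (subst Z.nn_integral_fst[symmetric]) auto
  also have "\<dots> = (\<integral>\<^sup>+ z. \<integral>\<^sup>+ c. F c z \<partial>PiM J (\<lambda>_. CN) \<partial>(CN \<Otimes>\<^sub>M CN)) ^ card {..<n}"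
    unfolding noise_def by (rule nn_integral_iterated_prod[OF prob_space_PiM_CN prob_space_CN_pair _ F]) simp
  finally show ?thesis by simp
qed

lemma emeasure_le_nn_integral_dominating:
  assumes "\<And>x. x \<in> space M \<Longrightarrow> x \<in> E \<Longrightarrow> 1 \<le> f x"
  shows "emeasure M E \<le> (\<integral>\<^sup>+ x. f x \<partial>M)"
proof (cases "E \<in> sets M")
  case True
  then have "emeasure M E = (\<integral>\<^sup>+ x. indicator E x \<partial>M)" by simp
  also have "\<dots> \<le> (\<integral>\<^sup>+ x. f x \<partial>M)"
    by (intro nn_integral_mono) (auto simp: assms indicator_def)
  finally show ?thesis .
\<comment> \<open>A set outside the sigma-algebra has \<open>emeasure\<close> 0 by
  convention.\<close>
qed (simp add: emeasure_notin_sets)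

lemma measurable_CN_pair_component:
  assumes "pr \<in> {fst, snd}"
  shows "pr \<in> borel_measurable (CN \<Otimes>\<^sub>M CN)"
proof -
  have "measurable (CN \<Otimes>\<^sub>M CN) borel = measurable (CN \<Otimes>\<^sub>M CN) CN"
    by (rule measurable_cong_sets) simp_all
  then show ?thesis using assms by auto
qed

lemma measurable_letter_sum:
  assumes "t < n" "K \<subseteq> J"
  shows "(\<lambda>p. \<Sum>j\<in>K. a j * fst p t j) \<in> borel_measurable (code_noise n J)"
  using measurable_compose[OF measurable_letter_pair[OF assms(1)]
      measurable_compose[OF measurable_fst measurable_linear_PiM_CN[OF assms(2)]]] by simp

lemma measurable_letter_component:
  assumes "t < n" "q \<in> J"
  shows "(\<lambda>p. fst p t q) \<in> borel_measurable (code_noise n J)"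
  using measurable_compose[OF measurable_letter_pair[OF assms(1)]
      measurable_compose[OF measurable_fst measurable_component_PiM_CN[OF assms(2)]]] by simp

lemma measurable_letter_noise:
  assumes "t < n" "pr \<in> {fst, snd}"
  shows "(\<lambda>p. pr (snd p t)) \<in> borel_measurable (code_noise n J)"
  using measurable_compose[OF measurable_letter_pair[OF assms(1)]
      measurable_compose[OF measurable_snd measurable_CN_pair_component[OF assms(2)]]] by simp

section \<open>Chernoff bounds for the error events\<close>

lemma nn_integral_code_power:
  fixes a :: "'j \<Rightarrow> complex"
  assumes J: "finite J" "U \<subseteq> J" and P: "P = (\<Sum>j\<in>U. (cmod (a j))\<^sup>2)" and l: "l * P < 1"
  shows "(\<integral>\<^sup>+ z. \<integral>\<^sup>+ c. ennreal (exp (l * ((cmod (\<Sum>j\<in>U. a j * c j))\<^sup>2 - 1))) \<partial>PiM J (\<lambda>_. CN) \<partial>(CN \<Otimes>\<^sub>M CN))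
    = ennreal (exp (- l) / (1 - l * P))"
proof -
  interpret PJ: prob_space "PiM J (\<lambda>_. CN)" by (rule prob_space_PiM_CN)
  interpret PZ: prob_space "CN \<Otimes>\<^sub>M CN" by (rule prob_space_CN_pair)
  have "(\<integral>\<^sup>+ c. ennreal (exp (l * ((cmod (\<Sum>j\<in>U. a j * c j))\<^sup>2 - 1))) \<partial>PiM J (\<lambda>_. CN))
     = (\<integral>\<^sup>+ c. ennreal (exp (- l)) * ennreal (exp (- (- l) * (cmod (0 + (\<Sum>j\<in>U. a j * c j)))\<^sup>2)) \<partial>PiM J (\<lambda>_. CN))"
    by (intro nn_integral_cong) (simp add: right_diff_distrib flip: ennreal_mult exp_add)
  also have "\<dots> = (\<integral>\<^sup>+ c. ennreal (exp (- l)) * ennreal (exp (- (- l / (1 + - l * P)) * (cmod 0)\<^sup>2) / (1 + - l * P)) \<partial>PiM J (\<lambda>_. CN))"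
    unfolding P using l unfolding P by (intro nn_integral_PiM_CN_gaussian J) auto
  also have "\<dots> = ennreal (exp (- l) / (1 - l * P))"
    using l by (simp add: PJ.emeasure_space_1 flip: ennreal_mult)
  finally show ?thesis by (simp add: PZ.emeasure_space_1)
qed

text \<open>Chernoff bound: on the event, the exponential of \<open>l\<close> times the excess
  energy is at least 1, and its expectation is an \<open>n\<close>-th power.\<close>

lemma emeasure_power_violation:
  fixes a :: "'j \<Rightarrow> complex"
  assumes J: "finite J" "U \<subseteq> J" and P: "P = (\<Sum>j\<in>U. (cmod (a j))\<^sup>2)" and l: "0 < l" "l * P < 1"
  shows "emeasure (code_noise n J) {p \<in> space (code_noise n J). real n < (\<Sum>t<n. (cmod (\<Sum>j\<in>U. a j * fst p t j))\<^sup>2)}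
     \<le> ennreal ((exp (- l) / (1 - l * P)) ^ n)"
proof -
  define F where "F c (z :: complex \<times> complex) = ennreal (exp (l * ((cmod (\<Sum>j\<in>U. a j * c j))\<^sup>2 - 1)))" for c z
  have lin: "(\<lambda>p. \<Sum>j\<in>U. a j * fst p j) \<in> borel_measurable (PiM J (\<lambda>_. CN) \<Otimes>\<^sub>M (CN \<Otimes>\<^sub>M CN))"
    by (rule measurable_compose[OF measurable_fst measurable_linear_PiM_CN[OF J(2)]])
  have F: "(\<lambda>p. F (fst p) (snd p)) \<in> borel_measurable (PiM J (\<lambda>_. CN) \<Otimes>\<^sub>M (CN \<Otimes>\<^sub>M CN))"
    unfolding F_def by (rule measurable_compose[OF lin]) measurable
  have "emeasure (code_noise n J) {p \<in> space (code_noise n J). real n < (\<Sum>t<n. (cmod (\<Sum>j\<in>U. a j * fst p t j))\<^sup>2)}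
    \<le> (\<integral>\<^sup>+ p. (\<Prod>t<n. F (fst p t) (snd p t)) \<partial>code_noise n J)"
  proof (rule emeasure_le_nn_integral_dominating)
    fix p assume "p \<in> {p \<in> space (code_noise n J). real n < (\<Sum>t<n. (cmod (\<Sum>j\<in>U. a j * fst p t j))\<^sup>2)}"
    then have "0 \<le> l * (\<Sum>t<n. (cmod (\<Sum>j\<in>U. a j * fst p t j))\<^sup>2 - 1)"
      using l by (simp add: sum_subtractf)
    moreover have "(\<Prod>t<n. F (fst p t) (snd p t)) = ennreal (exp (l * (\<Sum>t<n. (cmod (\<Sum>j\<in>U. a j * fst p t j))\<^sup>2 - 1)))"
      unfolding F_def sum_distrib_left by (simp add: prod_ennreal exp_sum)
    ultimately show "1 \<le> (\<Prod>t<n. F (fst p t) (snd p t))"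
      by (simp add: ennreal_1[symmetric] ennreal_leI del: ennreal_1)
  qed
  also have "\<dots> = ennreal (exp (- l) / (1 - l * P)) ^ n"
    using nn_integral_code_power[OF J P l(2)]
    by (subst nn_integral_code_noise_prod[OF F]) (simp add: F_def)
  also have "\<dots> = ennreal ((exp (- l) / (1 - l * P)) ^ n)"
    using l by (simp add: ennreal_power)
  finally show ?thesis .
qed

text \<open>The threshold argument: \<open>exp (n * r)\<close> acts as \<open>\<theta>\<close> up to
  normalisation. Each \<open>V k\<close> avoids \<open>q\<close> and \<open>U\<close>, hence is
  independent of the received word. The union bound over \<open>K\<close> affects only the
  competitor term; the term for an untypical true codeword is paid once. The parameters
  \<open>s\<close> and \<open>r\<close> are tuned later.\<close>

lemma emeasure_competitor_closer:
  fixes a :: "'j \<Rightarrow> complex" and V :: "'k \<Rightarrow> 'j set"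
  assumes J: "finite J" "U \<subseteq> J" "q \<in> J" "q \<notin> U" and pr: "pr \<in> {fst, snd}"
    and s: "0 < s" "s < 1"
    and N: "N = 1 + (cmod b)\<^sup>2" and P: "P = (\<Sum>j\<in>U. (cmod (a j))\<^sup>2)"
    and K: "finite K" "\<And>k. k \<in> K \<Longrightarrow> V k \<subseteq> J" "\<And>k. k \<in> K \<Longrightarrow> V k \<inter> insert q U = {}"
      "\<And>k. k \<in> K \<Longrightarrow> (\<Sum>j\<in>V k. (cmod (a j))\<^sup>2) = P"
  shows "emeasure (code_noise n J) {p \<in> space (code_noise n J). \<exists>k\<in>K.
        (\<Sum>t<n. (cmod (b * fst p t q + pr (snd p t) + (\<Sum>j\<in>U. a j * fst p t j) - (\<Sum>j\<in>V k. a j * fst p t j)))\<^sup>2)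
        \<le> (\<Sum>t<n. (cmod (b * fst p t q + pr (snd p t)))\<^sup>2)}
     \<le> ennreal ((exp (s * r) / (1 - s\<^sup>2 * P / (N + P))) ^ n + card K * (N / (N + P) * exp (- r)) ^ n)"
    (is "emeasure _ ?E \<le> _")
proof -
  define \<zeta> where "\<zeta> c z = b * c q + pr z" for c z
  define y where "y c z = b * c q + pr z + (\<Sum>j\<in>U. a j * c j)" for c z
  define v where "v k c = (\<Sum>j\<in>V k. a j * c j)" for k c
  define A where "A c z = ennreal (exp (s * ((cmod (\<zeta> c z))\<^sup>2 / N - (cmod (y c z))\<^sup>2 / (N + P))))" for c z
  define B where "B k c z = ennreal (exp ((cmod (y c z))\<^sup>2 / (N + P) - (cmod (y c z - v k c))\<^sup>2 / N))" for k c z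
  have N1: "N \<ge> 1" and P0: "P \<ge> 0" using N P by (auto simp: sum_nonneg)
  have exp_meas: "(\<lambda>p. ennreal (exp (k * ((cmod (f p))\<^sup>2 / C - (cmod (g p))\<^sup>2 / D)))) \<in> borel_measurable M"
    if [measurable]: "f \<in> borel_measurable M" "g \<in> borel_measurable M"
    for f g :: "('j \<Rightarrow> complex) \<times> complex \<times> complex \<Rightarrow> complex" and k C D M
    by measurable
  have \<zeta>_meas: "(\<lambda>p. \<zeta> (fst p) (snd p)) \<in> borel_measurable (PiM J (\<lambda>_. CN) \<Otimes>\<^sub>M (CN \<Otimes>\<^sub>M CN))"
    unfolding \<zeta>_def
    by (intro borel_measurable_add borel_measurable_times borel_measurable_const
        measurable_compose[OF measurable_fst measurable_component_PiM_CN[OF J(3)]]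
        measurable_compose[OF measurable_snd measurable_CN_pair_component[OF pr]])
  have y_meas: "(\<lambda>p. y (fst p) (snd p)) \<in> borel_measurable (PiM J (\<lambda>_. CN) \<Otimes>\<^sub>M (CN \<Otimes>\<^sub>M CN))"
    using \<zeta>_meas unfolding y_def \<zeta>_def
    by (rule borel_measurable_add) (rule measurable_compose[OF measurable_fst measurable_linear_PiM_CN[OF J(2)]])
  have v_meas: "(\<lambda>p. v k (fst p)) \<in> borel_measurable (PiM J (\<lambda>_. CN) \<Otimes>\<^sub>M (CN \<Otimes>\<^sub>M CN))" if "k \<in> K" for k
    unfolding v_def by (rule measurable_compose[OF measurable_fst measurable_linear_PiM_CN[OF K(2)[OF that]]])
  have A_meas: "(\<lambda>p. A (fst p) (snd p)) \<in> borel_measurable (PiM J (\<lambda>_. CN) \<Otimes>\<^sub>M (CN \<Otimes>\<^sub>M CN))"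
    unfolding A_def by (rule exp_meas[OF \<zeta>_meas y_meas])
  have B_meas: "(\<lambda>p. B k (fst p) (snd p)) \<in> borel_measurable (PiM J (\<lambda>_. CN) \<Otimes>\<^sub>M (CN \<Otimes>\<^sub>M CN))" if "k \<in> K" for k
    using exp_meas[OF y_meas borel_measurable_diff[OF y_meas v_meas[OF that]], of 1] unfolding B_def by simp
  have prod_meas: "(\<lambda>p. \<Prod>t<n. F (fst p t) (snd p t)) \<in> borel_measurable (code_noise n J)"
    if "(\<lambda>p. F (fst p) (snd p)) \<in> borel_measurable (PiM J (\<lambda>_. CN) \<Otimes>\<^sub>M (CN \<Otimes>\<^sub>M CN))"
    for F :: "('j \<Rightarrow> complex) \<Rightarrow> complex \<times> complex \<Rightarrow> ennreal"
    using measurable_compose[OF measurable_letter_pair that]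
    by (intro borel_measurable_prod_ennreal) auto
  have EA: "(\<integral>\<^sup>+ z. \<integral>\<^sup>+ c. A c z \<partial>PiM J (\<lambda>_. CN) \<partial>(CN \<Otimes>\<^sub>M CN)) = ennreal (1 / (1 - s\<^sup>2 * P / (N + P)))"
    unfolding A_def \<zeta>_def y_def by (rule nn_integral_tilted_density[OF J pr s N P])
  have EB: "(\<integral>\<^sup>+ z. \<integral>\<^sup>+ c. B k c z \<partial>PiM J (\<lambda>_. CN) \<partial>(CN \<Otimes>\<^sub>M CN)) = ennreal (N / (N + P))" if k: "k \<in> K" for k
    unfolding B_def v_def
  proof (rule nn_integral_competitor_ratio)
    show "(\<lambda>c. y c z) \<in> borel_measurable (PiM J (\<lambda>_. CN))" for z
      unfolding y_def
      by (intro borel_measurable_add borel_measurable_times borel_measurable_const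
          measurable_component_PiM_CN[OF J(3)] measurable_linear_PiM_CN[OF J(2)])
    fix c z j g assume j: "j \<in> V k"
    then have "j \<noteq> q" "j \<notin> U" using K(3)[OF k] by auto
    then show "y (c(j := g)) z = y c z"
      unfolding y_def by (auto intro!: sum.cong)
  qed (use J(1) K k N1 in auto)
  have "emeasure (code_noise n J) ?E \<le> (\<integral>\<^sup>+ p. ennreal (exp (s * (n * r))) * (\<Prod>t<n. A (fst p t) (snd p t))
      + ennreal (exp (- (n * r))) * (\<Sum>k\<in>K. \<Prod>t<n. B k (fst p t) (snd p t)) \<partial>code_noise n J)"
  proof (rule emeasure_le_nn_integral_dominating)
    fix p assume "p \<in> ?E"
    then obtain k where k: "k \<in> K"
      and le: "(\<Sum>t<n. (cmod (y (fst p t) (snd p t) - v k (fst p t)))\<^sup>2) \<le> (\<Sum>t<n. (cmod (\<zeta> (fst p t) (snd p t)))\<^sup>2)"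
      by (auto simp: y_def v_def \<zeta>_def)
    \<comment> \<open>Logarithm of \<open>\<theta> Q / q\<close>. If it is nonnegative, the first
      summand of the bound is at least 1. Otherwise the competitor, being no farther than the truth,
      exceeds the threshold and its own summand is at least 1.\<close>
    define L where "L = n * r + (\<Sum>t<n. (cmod (\<zeta> (fst p t) (snd p t)))\<^sup>2) / N - (\<Sum>t<n. (cmod (y (fst p t) (snd p t)))\<^sup>2) / (N + P)"
    have PA: "ennreal (exp (s * (n * r))) * (\<Prod>t<n. A (fst p t) (snd p t)) = ennreal (exp (s * L))"
    proof -
      have "s * L = s * (n * r) + (\<Sum>t<n. s * ((cmod (\<zeta> (fst p t) (snd p t)))\<^sup>2 / N - (cmod (y (fst p t) (snd p t)))\<^sup>2 / (N + P)))"
        unfolding sum_distrib_left[symmetric] sum_subtractf L_def sum_divide_distrib by (simp add: algebra_simps)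
      then show ?thesis unfolding A_def by (simp add: prod_ennreal exp_sum exp_add ennreal_mult prod_nonneg)
    qed
    have PB: "ennreal (exp (- (n * r))) * (\<Prod>t<n. B k (fst p t) (snd p t)) = ennreal (exp (- (n * r) + (\<Sum>t<n. (cmod (y (fst p t) (snd p t)))\<^sup>2) / (N + P)
       - (\<Sum>t<n. (cmod (y (fst p t) (snd p t) - v k (fst p t)))\<^sup>2) / N))"
    proof -
      have eq: "- (n * r) + (\<Sum>t<n. (cmod (y (fst p t) (snd p t)))\<^sup>2) / (N + P) - (\<Sum>t<n. (cmod (y (fst p t) (snd p t) - v k (fst p t)))\<^sup>2) / N
        = - (n * r) + (\<Sum>t<n. ((cmod (y (fst p t) (snd p t)))\<^sup>2 / (N + P) - (cmod (y (fst p t) (snd p t) - v k (fst p t)))\<^sup>2 / N))"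
        unfolding sum_subtractf sum_divide_distrib by simp
      show ?thesis
        unfolding eq B_def exp_add exp_sum[OF finite_lessThan]
        by (simp add: ennreal_mult prod_ennreal prod_nonneg)
    qed
    show "1 \<le> ennreal (exp (s * (n * r))) * (\<Prod>t<n. A (fst p t) (snd p t))
      + ennreal (exp (- (n * r))) * (\<Sum>k\<in>K. \<Prod>t<n. B k (fst p t) (snd p t))"
    proof (cases "L \<ge> 0")
      case True
      then have "1 \<le> ennreal (exp (s * (n * r))) * (\<Prod>t<n. A (fst p t) (snd p t))"
        unfolding PA using s by simp
      then show ?thesis by (rule order_trans) simp
    next
      case False
      have "(\<Sum>t<n. (cmod (y (fst p t) (snd p t) - v k (fst p t)))\<^sup>2) / N \<le> (\<Sum>t<n. (cmod (\<zeta> (fst p t) (snd p t)))\<^sup>2) / N"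
        using le N1 by (intro divide_right_mono) auto
      then have "1 \<le> ennreal (exp (- (n * r))) * (\<Prod>t<n. B k (fst p t) (snd p t))"
        unfolding PB using False by (simp add: L_def)
      also have "\<dots> \<le> ennreal (exp (- (n * r))) * (\<Sum>k\<in>K. \<Prod>t<n. B k (fst p t) (snd p t))"
        using k K(1) by (intro mult_left_mono member_le_sum) auto
      finally show ?thesis by (rule order_trans) simp
    qed
  qed
  also have "\<dots> = ennreal (exp (s * (n * r))) * (\<integral>\<^sup>+ p. (\<Prod>t<n. A (fst p t) (snd p t)) \<partial>code_noise n J)
     + ennreal (exp (- (n * r))) * (\<Sum>k\<in>K. \<integral>\<^sup>+ p. (\<Prod>t<n. B k (fst p t) (snd p t)) \<partial>code_noise n J)"
    using prod_meas[OF A_meas] prod_meas[OF B_meas]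
    by (subst nn_integral_add)
      (auto intro!: borel_measurable_sum borel_measurable_times_ennreal simp: nn_integral_sum nn_integral_cmult)
  also have "\<dots> = ennreal (exp (s * (n * r))) * ennreal (1 / (1 - s\<^sup>2 * P / (N + P))) ^ n
     + ennreal (exp (- (n * r))) * (\<Sum>k\<in>K. ennreal (N / (N + P)) ^ n)"
    using EA EB by (simp add: nn_integral_code_noise_prod A_meas B_meas)
  also have "\<dots> = ennreal ((exp (s * r) / (1 - s\<^sup>2 * P / (N + P))) ^ n + card K * (N / (N + P) * exp (- r)) ^ n)"
  proof -
    have "s\<^sup>2 * P \<le> 1 * P" using s P0 by (intro mult_right_mono) (auto simp: power_le_one)
    then have k: "0 \<le> 1 / (1 - s\<^sup>2 * P / (N + P))" using N1 P0 by simp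
    have 1: "exp (s * (n * r)) = exp (s * r) ^ n" "exp (- (n * r)) = exp (- r) ^ n"
      by (simp_all add: mult.left_commute flip: exp_of_nat_mult)
    have "ennreal (exp (s * (n * r))) * ennreal (1 / (1 - s\<^sup>2 * P / (N + P))) ^ n = ennreal ((exp (s * r) / (1 - s\<^sup>2 * P / (N + P))) ^ n)"
      unfolding 1 ennreal_power[OF k] by (subst ennreal_mult[symmetric]) (use k in \<open>auto simp: power_divide\<close>)
    moreover have "ennreal (exp (- (n * r))) * (\<Sum>k\<in>K. ennreal (N / (N + P)) ^ n) = ennreal (card K * (N / (N + P) * exp (- r)) ^ n)"
      unfolding 1 using N1 P0
      by (simp add: ennreal_power ennreal_of_nat_eq_real_of_nat power_mult_distrib power_divide mult_ac flip: ennreal_mult)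
    ultimately show ?thesis using k N1 P0 by (simp add: ennreal_plus)
  qed
  finally show ?thesis .
qed

section \<open>Measurability of the error events\<close>

lemma sets_power_violation:
  assumes "U \<subseteq> J"
  shows "{p \<in> space (code_noise n J). real n < (\<Sum>t<n. (cmod (\<Sum>j\<in>U. a j * fst p t j))\<^sup>2)} \<in> sets (code_noise n J)"
proof -
  have "(\<lambda>p. \<Sum>t<n. (cmod (\<Sum>j\<in>U. a j * fst p t j))\<^sup>2) \<in> borel_measurable (code_noise n J)"
    by (intro borel_measurable_sum borel_measurable_power measurable_compose[OF _ borel_measurable_norm] measurable_letter_sum assms) simp
  then show ?thesis by simp
qed

lemma sets_competitor_closer:
  assumes J: "U \<subseteq> J" "q \<in> J" and pr: "pr \<in> {fst, snd}"
    and K: "finite K" "\<And>k. k \<in> K \<Longrightarrow> V k \<subseteq> J"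
  shows "{p \<in> space (code_noise n J). \<exists>k\<in>K.
        (\<Sum>t<n. (cmod (b * fst p t q + pr (snd p t) + (\<Sum>j\<in>U. a j * fst p t j) - (\<Sum>j\<in>V k. a j * fst p t j)))\<^sup>2)
        \<le> (\<Sum>t<n. (cmod (b * fst p t q + pr (snd p t)))\<^sup>2)} \<in> sets (code_noise n J)"
proof (rule sets.sets_Collect_finite_Ex[OF _ K(1)])
  fix k assume k: "k \<in> K"
  have "(\<lambda>p. \<Sum>t<n. (cmod (b * fst p t q + pr (snd p t) + (\<Sum>j\<in>U. a j * fst p t j) - (\<Sum>j\<in>V k. a j * fst p t j)))\<^sup>2)
      \<in> borel_measurable (code_noise n J)"
    by (intro borel_measurable_sum borel_measurable_power measurable_compose[OF _ borel_measurable_norm] borel_measurable_add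
        borel_measurable_diff borel_measurable_times borel_measurable_const
        measurable_letter_sum measurable_letter_component measurable_letter_noise J pr K(2) k) simp_all
  moreover have "(\<lambda>p. \<Sum>t<n. (cmod (b * fst p t q + pr (snd p t)))\<^sup>2) \<in> borel_measurable (code_noise n J)"
    by (intro borel_measurable_sum borel_measurable_power measurable_compose[OF _ borel_measurable_norm] borel_measurable_add
        borel_measurable_times borel_measurable_const
        measurable_letter_component measurable_letter_noise J pr) simp_all
  ultimately show "{p \<in> space (code_noise n J). 
        (\<Sum>t<n. (cmod (b * fst p t q + pr (snd p t) + (\<Sum>j\<in>U. a j * fst p t j) - (\<Sum>j\<in>V k. a j * fst p t j)))\<^sup>2)
        \<le> (\<Sum>t<n. (cmod (b * fst p t q + pr (snd p t)))\<^sup>2)} \<in> sets (code_noise n J)"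
    by simp
qed

section \<open>Choice of the exponents\<close>

text \<open>At \<open>l = 0\<close> the quotient is 1 with derivative \<open>P - 1 < 0\<close>, so a
  small \<open>l\<close> suffices. With \<open>exp l \<ge> 1 + l\<close> it is enough that
  \<open>l * P < 1 - P\<close>.\<close>

lemma exponent_power:
  fixes P :: real
  assumes "0 \<le> P" "P < 1"
  shows "\<exists>l \<rho>. 0 < l \<and> l * P < 1 \<and> 0 < \<rho> \<and> \<rho> < 1 \<and> exp (- l) / (1 - l * P) \<le> \<rho>"
proof -
  define l where "l = (1 - P) / 2"
  have l: "0 < l" "l < 1" using assms by (auto simp: l_def)
  have lP: "l * P < 1 - P" using assms mult_left_mono[of P 1 l] l by (simp add: l_def field_simps)
  have pos: "1 - l * P > 0" using lP assms by simp
  have "l * (l * P) < l * (1 - P)" using lP l by simp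
  then have "1 < (1 + l) * (1 - l * P)" by (simp add: algebra_simps)
  also have "\<dots> \<le> exp l * (1 - l * P)" using pos exp_ge_add_one_self[of l] by (intro mult_right_mono) auto
  finally have "exp (- l) / (1 - l * P) < 1" using pos by (simp add: exp_minus field_simps)
  then show ?thesis using l pos
    by (intro exI[of _ l] exI[of _ "exp (- l) / (1 - l * P)"]) auto
qed

text \<open>Let \<open>d\<close> be half the gap between mutual information and rate, in nats. With
  \<open>r' = - d\<close> the competitor term becomes \<open>exp (- d)\<close>, while in the other
  term the linear gain \<open>s * d\<close> beats the quadratic loss in \<open>s\<close> once
  \<open>s\<close> is small.\<close>

lemma exponent_decoding:
  fixes N P r :: real
  assumes "N > 0" "P \<ge> 0" "r < log 2 (1 + P / N)"
  shows "\<exists>s r' \<rho>. 0 < s \<and> s < 1 \<and> 0 < \<rho> \<and> \<rho> < 1 \<and>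
     exp (s * r') / (1 - s\<^sup>2 * P / (N + P)) \<le> \<rho> \<and> 2 powr r * (N / (N + P) * exp (- r')) \<le> \<rho>"
proof -
  define I where "I = ln ((N + P) / N)"
  have eq: "1 + P / N = (N + P) / N" using assms by (simp add: field_simps)
  have rI: "r * ln 2 < I"
    using assms unfolding eq I_def log_def by (simp add: field_simps)
  define d where "d = (I - r * ln 2) / 2"
  have d: "d > 0" using rI by (simp add: d_def)
  define s where "s = min (1/2) (d/2)"
  have s: "0 < s" "s < 1" "s \<le> d / 2" "s \<le> 1/2" using d by (auto simp: s_def)
  define \<kappa> where "\<kappa> = P / (N + P)"
  have \<kappa>: "0 \<le> \<kappa>" "\<kappa> < 1" using assms by (auto simp: \<kappa>_def)
  have ss: "s\<^sup>2 \<le> 1/4" using power_mono[of s "1/2" 2] s by (simp add: power2_eq_square)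
  have pos: "1 - s\<^sup>2 > 0" using ss by simp
  have le: "1 - s\<^sup>2 \<le> 1 - s\<^sup>2 * \<kappa>" using \<kappa> by (simp add: mult_left_le)
  \<comment> \<open>This is the expanded form of \<open>1 < (1 + s * d) * (1 - s\<^sup>2)\<close>;
    the two caps in the definition of \<open>s\<close> bound its summands by \<open>d / 2\<close>
    and \<open>d / 4\<close>.\<close>
  have "s + s\<^sup>2 * d < d"
  proof -
    have "s\<^sup>2 * d \<le> 1/4 * d" using ss d by (intro mult_right_mono) auto
    then show ?thesis using s(3) d by linarith
  qed
  then have "s * (s + s\<^sup>2 * d) < s * d" using s by simp
  then have "1 < (1 + s * d) * (1 - s\<^sup>2)" by (simp add: algebra_simps power2_eq_square)
  also have "\<dots> \<le> exp (s * d) * (1 - s\<^sup>2 * \<kappa>)"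
    using pos le exp_ge_add_one_self[of "s * d"] by (intro mult_mono) auto
  finally have 1: "exp (s * (- d)) / (1 - s\<^sup>2 * \<kappa>) < 1"
    using pos le by (simp add: exp_minus field_simps)
  have 2: "2 powr r * (N / (N + P) * exp d) = exp (- d)"
  proof -
    have "N / (N + P) = exp (- I)" using assms by (simp add: I_def exp_minus)
    then have "2 powr r * (N / (N + P) * exp d) = exp (r * ln 2 + - I + d)"
      by (simp only: exp_add) (simp add: powr_def)
    also have "r * ln 2 + - I + d = - d" by (simp add: d_def field_simps)
    finally show ?thesis .
  qed
  define \<rho> where "\<rho> = max (exp (s * (- d)) / (1 - s\<^sup>2 * \<kappa>)) (exp (- d))"
  have "0 < \<rho>" "\<rho> < 1" using 1 d by (auto simp: \<rho>_def less_max_iff_disj)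
  then show ?thesis using s 2 unfolding \<kappa>_def
    by (intro exI[of _ s] exI[of _ "- d"] exI[of _ \<rho>]) (auto simp: \<rho>_def \<kappa>_def)
qed

text \<open>Only labels have to be separated: hypotheses sharing a label may lie at any distance
  from each other. Receivers use this to ignore errors in the other user's common index.\<close>

lemma min_distance_decoder:
  fixes S :: "'h \<Rightarrow> nat \<Rightarrow> complex" and lab :: "'h \<Rightarrow> nat \<times> nat"
  assumes "finite H"
  shows "\<exists>g \<in> measurable (PiM {..<n} (\<lambda>_. borel)) (count_space UNIV).
     \<forall>y\<in>space (PiM {..<n} (\<lambda>_. borel)). \<forall>h\<in>H.
       (\<forall>h'\<in>H. lab h' \<noteq> lab h \<longrightarrow> (\<Sum>t<n. (cmod (y t - S h t))\<^sup>2) < (\<Sum>t<n. (cmod (y t - S h' t))\<^sup>2)) \<longrightarrow> g y = lab h"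
proof -
  let ?M = "PiM {..<n} (\<lambda>_. borel) :: (nat \<Rightarrow> complex) measure"
  define d where "d h y = (\<Sum>t<n. (cmod (y t - S h t))\<^sup>2)" for h y
  \<comment> \<open>The strict inequality makes the winning label unique, so \<open>THE\<close> is
    well defined where it matters; elsewhere the decoder's value is arbitrary. Finiteness of
    \<open>H\<close> gives measurability.\<close>
  define R where "R l y \<longleftrightarrow> (\<exists>h\<in>H. lab h = l \<and> (\<forall>h'\<in>H. lab h' \<noteq> l \<longrightarrow> d h y < d h' y))" for l y
  have d_meas [measurable]: "d h \<in> borel_measurable ?M" for h
    unfolding d_def by measurable
  have unique: "l = l'" if "R l y" "R l' y" for l l' y
    using that unfolding R_def by (metis less_asym)
  have "(\<lambda>y. THE l. R l y) \<in> measurable ?M (count_space UNIV)"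
  proof (rule measurable_THE)
    show "Measurable.pred ?M (R l)" for l
      unfolding R_def using assms by measurable
    show "countable (lab ` H)" using assms by (simp add: countable_finite)
    show "l \<in> lab ` H" if "R l y" for l y using that by (auto simp: R_def)
  qed (use unique in blast)
  moreover have "(THE l. R l y) = lab h"
    if "h \<in> H" "\<forall>h'\<in>H. lab h' \<noteq> lab h \<longrightarrow> d h y < d h' y" for h y
  proof -
    have "R (lab h) y" using that by (auto simp: R_def)
    then show ?thesis using unique by blast
  qed
  ultimately show ?thesis unfolding d_def by (intro bexI[of _ "\<lambda>y. THE l. R l y"]) auto
qed

section \<open>Superposition codes\<close>

text \<open>Names of the independent codewords; the boolean is the user, with \<open>True\<close>
  for user 1. A \<open>Common\<close> label carries \<open>m0\<close> and the common index, a
  \<open>Private\<close> label carries \<open>m0\<close> and the whole individual message.\<close>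

datatype label = Common bool nat nat | Private bool nat nat

text \<open>Received power of the codewords in which a competing triple of type \<open>f\<close>,
  \<open>g\<close> differs from the true one. The own private codeword always differs, as its label
  contains both \<open>m0\<close> and \<open>m\<close>.\<close>

definition part_power :: "(bool \<Rightarrow> bool \<Rightarrow> complex) \<Rightarrow> (bool \<Rightarrow> real) \<Rightarrow> (bool \<Rightarrow> real) \<Rightarrow> bool \<Rightarrow> bool \<Rightarrow> bool \<Rightarrow> real" where
  "part_power h \<beta> \<gamma> i f g = (cmod (h i i))\<^sup>2 * \<beta> i + (if f then (cmod (h i i))\<^sup>2 * \<gamma> i else 0)
     + (if g then (cmod (h i (\<not> i)))\<^sup>2 * \<gamma> (\<not> i) else 0)"

definition noise_power :: "(bool \<Rightarrow> bool \<Rightarrow> complex) \<Rightarrow> (bool \<Rightarrow> real) \<Rightarrow> bool \<Rightarrow> real" where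
  "noise_power h \<beta> i = 1 + (cmod (h i (\<not> i)))\<^sup>2 * \<beta> (\<not> i)"

text \<open>Users are booleans, so \<open>\<not> i\<close> is the other user and each statement
  covers both receivers. \<open>h i j\<close> is the gain from transmitter \<open>j\<close> to
  receiver \<open>i\<close>, \<open>\<beta>\<close> and \<open>\<gamma>\<close> are private and
  common powers, and \<open>\<kappa> i\<close> extracts the common index from a message.\<close>

locale split_code =
  fixes h :: "bool \<Rightarrow> bool \<Rightarrow> complex" and \<beta> \<gamma> :: "bool \<Rightarrow> real" and n :: nat
    and M0 :: "nat set" and M :: "bool \<Rightarrow> nat set" and \<kappa> :: "bool \<Rightarrow> nat \<Rightarrow> nat"
  assumes nonneg: "\<beta> i \<ge> 0" "\<gamma> i \<ge> 0" and fin: "finite M0" "finite (M i)"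
begin

fun amplitude :: "label \<Rightarrow> complex" where
  "amplitude (Common j _ _) = complex_of_real (sqrt (\<gamma> j))"
| "amplitude (Private j _ _) = complex_of_real (sqrt (\<beta> j))"

fun sender :: "label \<Rightarrow> bool" where
  "sender (Common j _ _) = j"
| "sender (Private j _ _) = j"

definition gain :: "bool \<Rightarrow> label \<Rightarrow> complex" where
  "gain i l = h i (sender l) * amplitude l"

definition word :: "bool \<Rightarrow> nat \<Rightarrow> nat \<Rightarrow> label set" where
  "word i m0 m = {Common i m0 (\<kappa> i m), Private i m0 m}"

definition labels :: "label set" where
  "labels = (\<Union>i. \<Union>m0\<in>M0. \<Union>m\<in>M i. word i m0 m)"

definition hyps :: "bool \<Rightarrow> (nat \<times> nat \<times> nat) set" where
  "hyps i = M0 \<times> M i \<times> \<kappa> (\<not> i) ` M (\<not> i)"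

text \<open>The part of the codewords decoded by receiver \<open>i\<close> under the hypothesis \<open>(m0, m, k)\<close>;
  \<open>f\<close> and \<open>g\<close> tell whether the own and the foreign common codeword are included.\<close>
fun decoded_part :: "bool \<Rightarrow> bool \<Rightarrow> bool \<Rightarrow> nat \<times> nat \<times> nat \<Rightarrow> label set" where
  "decoded_part i f g (m0, m, k) = insert (Private i m0 m)
     ((if f then {Common i m0 (\<kappa> i m)} else {}) \<union> (if g then {Common (\<not> i) m0 k} else {}))"

definition noise_comp :: "bool \<Rightarrow> complex \<times> complex \<Rightarrow> complex" where
  "noise_comp i = (if i then fst else snd)"

text \<open>A triple with the right \<open>(m0, m)\<close> but a wrong foreign index causes no
  decoding error and is left out. A wrong \<open>m0\<close> changes both common codewords, so it
  occurs only for \<open>f\<close> and \<open>g\<close> both true.\<close>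

fun competitors :: "bool \<Rightarrow> bool \<Rightarrow> bool \<Rightarrow> nat \<times> nat \<times> nat \<Rightarrow> (nat \<times> nat \<times> nat) set" where
  "competitors i f g (m0, m, k) = {(m0', m', k') \<in> hyps i. (m0', m') \<noteq> (m0, m)
     \<and> ((m0, \<kappa> i m) \<noteq> (m0', \<kappa> i m')) = f \<and> ((m0, k) \<noteq> (m0', k')) = g}"

text \<open>The comparison of distances is written after cancelling the shared codewords, in the
  shape required by \<open>emeasure_competitor_closer\<close>; the foreign private codeword belongs
  to the noise.\<close>

definition closer_event :: "bool \<Rightarrow> bool \<Rightarrow> bool \<Rightarrow> nat \<Rightarrow> nat \<Rightarrow> nat \<Rightarrow>
    ((nat \<Rightarrow> label \<Rightarrow> complex) \<times> (nat \<Rightarrow> complex \<times> complex)) set" where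
  "closer_event i f g m0 m m' = {p \<in> space (code_noise n labels).
     \<exists>b\<in>competitors i f g (m0, m, \<kappa> (\<not> i) m').
        (\<Sum>t<n. (cmod (gain i (Private (\<not> i) m0 m') * fst p t (Private (\<not> i) m0 m') + noise_comp i (snd p t)
            + (\<Sum>j\<in>decoded_part i f g (m0, m, \<kappa> (\<not> i) m'). gain i j * fst p t j) - (\<Sum>j\<in>decoded_part i f g b. gain i j * fst p t j)))\<^sup>2)
        \<le> (\<Sum>t<n. (cmod (gain i (Private (\<not> i) m0 m') * fst p t (Private (\<not> i) m0 m') + noise_comp i (snd p t)))\<^sup>2)}"

definition power_event :: "bool \<Rightarrow> nat \<Rightarrow> nat \<Rightarrow> ((nat \<Rightarrow> label \<Rightarrow> complex) \<times> (nat \<Rightarrow> complex \<times> complex)) set" where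
  "power_event i m0 m = {p \<in> space (code_noise n labels).
     real n < (\<Sum>t<n. (cmod (\<Sum>j\<in>word i m0 m. amplitude j * fst p t j))\<^sup>2)}"

definition bad_event :: "nat \<Rightarrow> (bool \<Rightarrow> nat) \<Rightarrow> ((nat \<Rightarrow> label \<Rightarrow> complex) \<times> (nat \<Rightarrow> complex \<times> complex)) set" where
  "bad_event m0 m = (\<Union>i. power_event i m0 (m i) \<union> (\<Union>f. \<Union>g. closer_event i f g m0 (m i) (m (\<not> i))))"

definition signal :: "(nat \<Rightarrow> label \<Rightarrow> complex) \<Rightarrow> bool \<Rightarrow> nat \<times> nat \<times> nat \<Rightarrow> nat \<Rightarrow> complex" where
  "signal c i b t = (\<Sum>j\<in>decoded_part i True True b. gain i j * c t j)"

definition encoder :: "(nat \<Rightarrow> label \<Rightarrow> complex) \<Rightarrow> bool \<Rightarrow> nat \<Rightarrow> nat \<Rightarrow> nat \<Rightarrow> complex" where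
  "encoder c i m0 m t = (if (\<Sum>t<n. (cmod (\<Sum>j\<in>word i m0 m. amplitude j * c t j))\<^sup>2) \<le> n
     then \<Sum>j\<in>word i m0 m. amplitude j * c t j else 0)"

lemma finite_labels: "finite labels"
  using fin by (auto simp: labels_def word_def)

lemma finite_hyps: "finite (hyps i)"
  using fin by (auto simp: hyps_def)

lemma finite_competitors: "finite (competitors i f g a)"
  by (cases a) (auto intro: finite_subset[OF _ finite_hyps[of i]])

lemma word_subset: "m0 \<in> M0 \<Longrightarrow> m \<in> M i \<Longrightarrow> word i m0 m \<subseteq> labels"
  by (auto simp: labels_def)

lemma private_in_labels: "m0 \<in> M0 \<Longrightarrow> m \<in> M i \<Longrightarrow> Private i m0 m \<in> labels"
  by (auto simp: labels_def word_def)

lemma part_subset: "b \<in> hyps i \<Longrightarrow> decoded_part i f g b \<subseteq> labels"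
  by (cases b) (auto simp: labels_def word_def hyps_def)

lemma finite_part: "finite (decoded_part i f g b)"
  by (cases b) auto

lemma foreign_private_notin_part: "Private (\<not> i) m0 m \<notin> decoded_part i f g b"
  by (cases b) simp

lemma competitors_subset: "b \<in> competitors i f g a \<Longrightarrow> b \<in> hyps i"
  by (cases a) auto

text \<open>The type records exactly which common codewords are shared, and the private ones are
  never shared because \<open>(m0, m)\<close> differs. Hence true and competing parts of one type
  are disjoint.\<close>

lemma part_competitor_diff:
  assumes "b \<in> competitors i f g a"
  shows "decoded_part i True True a - decoded_part i True True b = decoded_part i f g a"
    and "decoded_part i True True b - decoded_part i True True a = decoded_part i f g b"
proof -
  obtain m0 m k m0' m' k' where ab: "a = (m0, m, k)" "b = (m0', m', k')" by (cases a, cases b)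
  have "(m0', m') \<noteq> (m0, m)" "f = ((m0, \<kappa> i m) \<noteq> (m0', \<kappa> i m'))" "g = ((m0, k) \<noteq> (m0', k'))"
    using assms by (auto simp: ab)
  then show "decoded_part i True True a - decoded_part i True True b = decoded_part i f g a"
    and "decoded_part i True True b - decoded_part i True True a = decoded_part i f g b"
    unfolding ab by auto
qed

lemma cmod_gain_sq:
  "(cmod (gain i (Common j a b)))\<^sup>2 = (cmod (h i j))\<^sup>2 * \<gamma> j"
  "(cmod (gain i (Private j a b)))\<^sup>2 = (cmod (h i j))\<^sup>2 * \<beta> j"
  using nonneg by (simp_all add: gain_def norm_mult power_mult_distrib)

lemma part_power_eq: "(\<Sum>j\<in>decoded_part i f g b. (cmod (gain i j))\<^sup>2) = part_power h \<beta> \<gamma> i f g"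
  by (cases b) (auto simp: part_power_def cmod_gain_sq)

lemma word_power_eq: "(\<Sum>j\<in>word i m0 m. (cmod (amplitude j))\<^sup>2) = \<beta> i + \<gamma> i"
  using nonneg by (simp add: word_def)

lemma noise_comp_in: "noise_comp i \<in> {fst, snd}"
  by (simp add: noise_comp_def)

lemma sets_bad_event:
  assumes "m0 \<in> M0" "\<And>i. m i \<in> M i"
  shows "power_event i m0 (m i) \<in> sets (code_noise n labels)"
    and "closer_event i f g m0 (m i) (m (\<not> i)) \<in> sets (code_noise n labels)"
    and "bad_event m0 m \<in> sets (code_noise n labels)"
proof -
  have 1: "power_event i m0 (m i) \<in> sets (code_noise n labels)" for i
    unfolding power_event_def by (intro sets_power_violation word_subset assms)
  have 2: "closer_event i f g m0 (m i) (m (\<not> i)) \<in> sets (code_noise n labels)" for i f g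
    unfolding closer_event_def
    by (intro sets_competitor_closer part_subset noise_comp_in finite_competitors private_in_labels assms)
      (auto simp: hyps_def assms dest: competitors_subset)
  show "power_event i m0 (m i) \<in> sets (code_noise n labels)"
    "closer_event i f g m0 (m i) (m (\<not> i)) \<in> sets (code_noise n labels)" by (rule 1 2)+
  show "bad_event m0 m \<in> sets (code_noise n labels)"
    unfolding bad_event_def by (intro sets.finite_UN sets.Un 1 2) auto
qed

lemma emeasure_closer_event:
  assumes m: "m0 \<in> M0" "m \<in> M i" "m' \<in> M (\<not> i)" and s: "0 < s" "s < 1"
  shows "emeasure (code_noise n labels) (closer_event i f g m0 m m') \<le>
    ennreal ((exp (s * r) / (1 - s\<^sup>2 * part_power h \<beta> \<gamma> i f g / (noise_power h \<beta> i + part_power h \<beta> \<gamma> i f g))) ^ n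
      + card (competitors i f g (m0, m, \<kappa> (\<not> i) m')) * (noise_power h \<beta> i / (noise_power h \<beta> i + part_power h \<beta> \<gamma> i f g) * exp (- r)) ^ n)"
  unfolding closer_event_def
proof (rule emeasure_competitor_closer)
  show "noise_power h \<beta> i = 1 + (cmod (gain i (Private (\<not> i) m0 m')))\<^sup>2"
    by (simp add: noise_power_def cmod_gain_sq)
  show "part_power h \<beta> \<gamma> i f g = (\<Sum>j\<in>decoded_part i f g (m0, m, \<kappa> (\<not> i) m'). (cmod (gain i j))\<^sup>2)"
    by (simp only: part_power_eq)
  fix b assume b: "b \<in> competitors i f g (m0, m, \<kappa> (\<not> i) m')"
  then show "decoded_part i f g b \<subseteq> labels" by (intro part_subset competitors_subset)
  have "Private (\<not> i) m0 m' \<notin> decoded_part i f g b" by (rule foreign_private_notin_part)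
  then show "decoded_part i f g b \<inter> insert (Private (\<not> i) m0 m') (decoded_part i f g (m0, m, \<kappa> (\<not> i) m')) = {}"
    unfolding part_competitor_diff[OF b, symmetric] by blast
  show "(\<Sum>j\<in>decoded_part i f g b. (cmod (gain i j))\<^sup>2) = part_power h \<beta> \<gamma> i f g" by (rule part_power_eq)
next
  show "decoded_part i f g (m0, m, \<kappa> (\<not> i) m') \<subseteq> labels"
    using m by (intro part_subset) (simp add: hyps_def)
qed (rule finite_labels private_in_labels[OF m(1,3)] foreign_private_notin_part noise_comp_in s finite_competitors)+

text \<open>The deterministic core of decoding: outside the bad event no codeword is truncated, so
  the received word is the true signal plus \<open>\<zeta>\<close>, and every wrongly labelled
  triple falls under one of the four excluded types.\<close>

lemma min_distance_outside_bad_event: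
  assumes m: "m0 \<in> M0" "\<And>i. m i \<in> M i" and p: "(c, z) \<in> space (code_noise n labels)" "(c, z) \<notin> bad_event m0 m"
    and y: "\<And>t. t < n \<Longrightarrow> y t = h i True * encoder c True m0 (m True) t + h i False * encoder c False m0 (m False) t + noise_comp i (z t)"
    and b: "b \<in> hyps i" "(fst b, fst (snd b)) \<noteq> (m0, m i)"
  shows "(\<Sum>t<n. (cmod (y t - signal c i (m0, m i, \<kappa> (\<not> i) (m (\<not> i))) t))\<^sup>2) < (\<Sum>t<n. (cmod (y t - signal c i b t))\<^sup>2)"
proof -
  let ?a = "(m0, m i, \<kappa> (\<not> i) (m (\<not> i)))"
  let ?q = "Private (\<not> i) m0 (m (\<not> i))"
  obtain m0' m' k' where b_eq: "b = (m0', m', k')" by (cases b)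
  define f where "f = ((m0, \<kappa> i (m i)) \<noteq> (m0', \<kappa> i m'))"
  define g where "g = ((m0, \<kappa> (\<not> i) (m (\<not> i))) \<noteq> (m0', k'))"
  have bc: "b \<in> competitors i f g ?a"
    using b by (simp add: b_eq f_def g_def)
  have enc: "encoder c j m0 (m j) t = (\<Sum>l\<in>word j m0 (m j). amplitude l * c t l)" for j t
    using p unfolding bad_event_def power_event_def encoder_def by (auto simp: not_less)
  define \<zeta> where "\<zeta> t = gain i ?q * c t ?q + noise_comp i (z t)" for t
  have y_eq: "y t = signal c i ?a t + \<zeta> t" if "t < n" for t
  proof -
    have "signal c i ?a t + gain i ?q * c t ?q = h i i * (\<Sum>l\<in>word i m0 (m i). amplitude l * c t l)
       + h i (\<not> i) * (\<Sum>l\<in>word (\<not> i) m0 (m (\<not> i)). amplitude l * c t l)"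
      by (simp add: signal_def word_def gain_def algebra_simps)
    then show ?thesis unfolding y[OF that] enc \<zeta>_def by (cases i) (simp_all add: algebra_simps)
  qed
  have d: "y t - signal c i b t = \<zeta> t + (\<Sum>j\<in>decoded_part i f g ?a. gain i j * c t j) - (\<Sum>j\<in>decoded_part i f g b. gain i j * c t j)"
    if "t < n" for t
  proof -
    \<comment> \<open>Codewords common to both hypotheses cancel in the difference of the
      signals.\<close>
    have "sum F A - sum F B = sum F (A - B) - sum F (B - A)" if "finite A" "finite B"
      for A B :: "label set" and F :: "label \<Rightarrow> complex"
    proof -
      have "sum F A = sum F (A - B) + sum F (A \<inter> B)" "sum F B = sum F (B - A) + sum F (A \<inter> B)"
        using that sum.Int_Diff[of A F B] sum.Int_Diff[of B F A] by (simp_all add: Int_commute add.commute)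
      then show ?thesis by simp
    qed
    from this[OF finite_part finite_part, of "\<lambda>j. gain i j * c t j" i True True ?a i True True b]
    show ?thesis
      unfolding y_eq[OF that] signal_def part_competitor_diff[OF bc] by (simp add: algebra_simps)
  qed
  have "(c, z) \<notin> closer_event i f g m0 (m i) (m (\<not> i))"
    using p unfolding bad_event_def by auto
  then have "(\<Sum>t<n. (cmod (\<zeta> t))\<^sup>2)
     < (\<Sum>t<n. (cmod (\<zeta> t + (\<Sum>j\<in>decoded_part i f g ?a. gain i j * c t j) - (\<Sum>j\<in>decoded_part i f g b. gain i j * c t j)))\<^sup>2)"
    using p(1) bc unfolding closer_event_def \<zeta>_def by (auto simp: not_le simp del: decoded_part.simps competitors.simps)
  moreover have "(\<Sum>t<n. (cmod (y t - signal c i ?a t))\<^sup>2) = (\<Sum>t<n. (cmod (\<zeta> t))\<^sup>2)"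
    by (intro sum.cong) (simp_all add: y_eq)
  moreover have "(\<Sum>t<n. (cmod (y t - signal c i b t))\<^sup>2)
     = (\<Sum>t<n. (cmod (\<zeta> t + (\<Sum>j\<in>decoded_part i f g ?a. gain i j * c t j) - (\<Sum>j\<in>decoded_part i f g b. gain i j * c t j)))\<^sup>2)"
    by (intro sum.cong) (simp_all only: d lessThan_iff)
  ultimately show ?thesis by (simp only:)
qed

end

section \<open>From random codebooks to one good code\<close>

lemma finite_msgs [simp]: "finite (msgs n R)"
  by (simp add: msgs_def)

lemma card_msgs: "card (msgs n R) = nat \<lceil>2 powr (real n * R)\<rceil>"
  by (simp add: msgs_def)

lemma card_msgs_pos: "card (msgs n R) > 0"
  by (simp add: card_msgs)

context split_code
begin

text \<open>If every codebook had total error above the bound, integrating over codebooks and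
  applying Fubini would contradict \<open>bad\<close>. The gap between \<open>\<epsilon>\<close> and
  \<open>\<epsilon>'\<close> yields the contradiction, since integration preserves only the weak
  inequality.\<close>

lemma exists_good_codebook:
  assumes ne: "M0 \<noteq> {}" "\<And>i. M i \<noteq> {}" and \<epsilon>: "0 \<le> \<epsilon>" "\<epsilon> < \<epsilon>'"
    and bad: "\<And>m0 m. m0 \<in> M0 \<Longrightarrow> (\<And>i. m i \<in> M i) \<Longrightarrow> emeasure (code_noise n labels) (bad_event m0 m) \<le> ennreal \<epsilon>"
  shows "\<exists>c\<in>space (PiM {..<n} (\<lambda>_. PiM labels (\<lambda>_. CN))).
     (\<Sum>m0\<in>M0. \<Sum>m1\<in>M True. \<Sum>m2\<in>M False.
        measure (noise n) {z \<in> space (noise n). (c, z) \<in> bad_event m0 (\<lambda>i. if i then m1 else m2)})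
     \<le> real (card M0) * real (card (M True)) * real (card (M False)) * \<epsilon>'"
proof (rule ccontr)
  define C where "C = PiM {..<n} (\<lambda>_. PiM labels (\<lambda>_. CN))"
  define T where "T = M0 \<times> M True \<times> M False"
  define E where "E = (\<lambda>(m0, m1, m2). bad_event m0 (\<lambda>i. if i then m1 else m2))"
  interpret C: prob_space C unfolding C_def by (rule prob_space_code)
  interpret Z: prob_space "noise n" by (rule prob_space_noise)
  have Q: "code_noise n labels = C \<Otimes>\<^sub>M noise n" by (simp add: code_noise_def C_def)
  have T: "finite T" "T \<noteq> {}" using fin ne by (auto simp: T_def)
  have E: "E \<tau> \<in> sets (C \<Otimes>\<^sub>M noise n)" "emeasure (C \<Otimes>\<^sub>M noise n) (E \<tau>) \<le> ennreal \<epsilon>" if "\<tau> \<in> T" for \<tau>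
    using that sets_bad_event(3) bad by (auto simp: T_def E_def Q)
  assume "\<not> ?thesis"
  then have gt: "real (card T) * \<epsilon>' < (\<Sum>\<tau>\<in>T. measure (noise n) {z \<in> space (noise n). (c, z) \<in> E \<tau>})"
    if "c \<in> space C" for c
    using that unfolding T_def E_def
    by (auto simp: sum.cartesian_product card_cartesian_product not_le mult.assoc C_def split_beta)
  have "ennreal (real (card T) * \<epsilon>') = (\<integral>\<^sup>+ c. ennreal (real (card T) * \<epsilon>') \<partial>C)"
    by (simp add: C.emeasure_space_1)
  also have "\<dots> \<le> (\<integral>\<^sup>+ c. (\<Sum>\<tau>\<in>T. emeasure (noise n) (Pair c -` E \<tau>)) \<partial>C)"
  proof (intro nn_integral_mono)
    fix c assume c: "c \<in> space C"
    have "{z \<in> space (noise n). (c, z) \<in> E \<tau>} = Pair c -` E \<tau>" if "\<tau> \<in> T" for \<tau>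
      using sets.sets_into_space[OF E(1)[OF that]] by (auto simp: space_pair_measure)
    then have "real (card T) * \<epsilon>' \<le> (\<Sum>\<tau>\<in>T. measure (noise n) (Pair c -` E \<tau>))"
      using gt[OF c] by simp
    then have "ennreal (real (card T) * \<epsilon>') \<le> ennreal (\<Sum>\<tau>\<in>T. measure (noise n) (Pair c -` E \<tau>))"
      by (rule ennreal_leI)
    also have "\<dots> = (\<Sum>\<tau>\<in>T. emeasure (noise n) (Pair c -` E \<tau>))"
      by (simp add: sum_ennreal Z.emeasure_eq_measure)
    finally show "ennreal (real (card T) * \<epsilon>') \<le> (\<Sum>\<tau>\<in>T. emeasure (noise n) (Pair c -` E \<tau>))" .
  qed
  also have "\<dots> = (\<Sum>\<tau>\<in>T. \<integral>\<^sup>+ c. emeasure (noise n) (Pair c -` E \<tau>) \<partial>C)"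
    using E(1) by (intro nn_integral_sum Z.measurable_emeasure_Pair) auto
  also have "\<dots> = (\<Sum>\<tau>\<in>T. emeasure (C \<Otimes>\<^sub>M noise n) (E \<tau>))"
    using E(1) by (intro sum.cong refl Z.emeasure_pair_measure_alt[symmetric]) auto
  also have "\<dots> \<le> (\<Sum>\<tau>\<in>T. ennreal \<epsilon>)"
    by (intro sum_mono E(2))
  also have "\<dots> = ennreal (real (card T) * \<epsilon>)"
    using \<epsilon> by (simp add: ennreal_mult ennreal_of_nat_eq_real_of_nat)
  finally have "real (card T) * \<epsilon>' \<le> real (card T) * \<epsilon>"
    using \<epsilon> by (simp add: ennreal_le_iff)
  moreover have "card T > 0" using T by (simp add: card_gt_0_iff)
  ultimately show False using \<epsilon> by simp
qed

text \<open>Truncation enforces the energy bound for each message pair separately, hence also on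
  average.\<close>

lemma power_ok_encoder:
  assumes "M0 = msgs n R0" "M i = msgs n R"
  shows "power_ok n R0 R (encoder c i)"
proof -
  have le: "(\<Sum>t<n. (cmod (encoder c i m0 m t))\<^sup>2) \<le> n" for m0 m
    by (cases "(\<Sum>t<n. (cmod (\<Sum>j\<in>word i m0 m. amplitude j * c t j))\<^sup>2) \<le> n") (simp_all add: encoder_def)
  let ?K = "real (card (msgs n R0)) * real (card (msgs n R))"
  have "(\<Sum>t<n. (\<Sum>m0\<in>msgs n R0. \<Sum>m\<in>msgs n R. (cmod (encoder c i m0 m t))\<^sup>2) / ?K)
     = (\<Sum>m0\<in>msgs n R0. \<Sum>m\<in>msgs n R. \<Sum>t<n. (cmod (encoder c i m0 m t))\<^sup>2) / ?K"
    by (subst sum_divide_distrib[symmetric], subst sum.swap, subst (2) sum.swap) simp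
  also have "\<dots> \<le> (\<Sum>m0\<in>msgs n R0. \<Sum>m\<in>msgs n R. real n) / ?K"
    by (intro divide_right_mono sum_mono le) auto
  also have "\<dots> = n"
    using card_msgs_pos[of n R0] card_msgs_pos[of n R] by (auto simp: card_gt_0_iff)
  \<comment> \<open>For \<open>n = 0\<close> the left-hand side is 0, because division by zero gives
    0.\<close>
  finally show ?thesis unfolding power_ok_def
    by (cases "n = 0") (simp_all add: field_simps)
qed

text \<open>For the good codebook, both receivers use minimum distance decoding. Any error forces
  the noise into the section of the bad event, so the averaged section measures bound
  \<open>err_prob\<close>.\<close>

lemma exists_code:
  assumes M: "M0 = msgs n R0" "M True = msgs n R1" "M False = msgs n R2" and \<epsilon>: "0 \<le> \<epsilon>" "\<epsilon> < \<epsilon>'"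
    and bad: "\<And>m0 m. m0 \<in> M0 \<Longrightarrow> (\<And>i. m i \<in> M i) \<Longrightarrow> emeasure (code_noise n labels) (bad_event m0 m) \<le> ennreal \<epsilon>"
  shows "\<exists>f1 f2 g1 g2. is_code n R0 R1 R2 f1 f2 g1 g2 \<and>
     err_prob (h True True) (h True False) (h False True) (h False False) n R0 R1 R2 f1 f2 g1 g2 \<le> \<epsilon>'"
proof -
  interpret Z: prob_space "noise n" by (rule prob_space_noise)
  have ne: "M0 \<noteq> {}" "M i \<noteq> {}" for i
    using card_msgs_pos[of n R0] card_msgs_pos[of n R1] card_msgs_pos[of n R2] M by (cases i; force)+
  from exists_good_codebook[OF ne \<epsilon> bad] obtain c where c: "c \<in> space (PiM {..<n} (\<lambda>_. PiM labels (\<lambda>_. CN)))"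
    and sum_le: "(\<Sum>m0\<in>M0. \<Sum>m1\<in>M True. \<Sum>m2\<in>M False.
        measure (noise n) {z \<in> space (noise n). (c, z) \<in> bad_event m0 (\<lambda>i. if i then m1 else m2)})
     \<le> real (card M0) * real (card (M True)) * real (card (M False)) * \<epsilon>'" by blast
  let ?lab = "\<lambda>b :: nat \<times> nat \<times> nat. (fst b, fst (snd b))"
  have "\<exists>g. \<forall>i. g i \<in> measurable (PiM {..<n} (\<lambda>_. borel)) (count_space UNIV) \<and>
     (\<forall>y\<in>space (PiM {..<n} (\<lambda>_. borel)). \<forall>b\<in>hyps i.
       (\<forall>b'\<in>hyps i. ?lab b' \<noteq> ?lab b \<longrightarrow> (\<Sum>t<n. (cmod (y t - signal c i b t))\<^sup>2) < (\<Sum>t<n. (cmod (y t - signal c i b' t))\<^sup>2))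
       \<longrightarrow> g i y = ?lab b)"
    using min_distance_decoder[OF finite_hyps, where lab = ?lab] by (intro choice allI) blast
  then obtain g where g: "\<And>i. g i \<in> measurable (PiM {..<n} (\<lambda>_. borel)) (count_space UNIV)"
    and dec: "\<And>i y b. y \<in> space (PiM {..<n} (\<lambda>_. borel)) \<Longrightarrow> b \<in> hyps i \<Longrightarrow>
       (\<And>b'. b' \<in> hyps i \<Longrightarrow> ?lab b' \<noteq> ?lab b \<Longrightarrow> (\<Sum>t<n. (cmod (y t - signal c i b t))\<^sup>2) < (\<Sum>t<n. (cmod (y t - signal c i b' t))\<^sup>2))
       \<Longrightarrow> g i y = ?lab b" by blast
  let ?o1 = "out1 (h True True) (h True False) (encoder c True) (encoder c False) n"
  let ?o2 = "out2 (h False True) (h False False) (encoder c True) (encoder c False) n"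
  have good: "g True (?o1 m0 m1 m2 z) = (m0, m1) \<and> g False (?o2 m0 m1 m2 z) = (m0, m2)"
    if m: "m0 \<in> M0" "m1 \<in> M True" "m2 \<in> M False" and z: "z \<in> space (noise n)"
      and nb: "(c, z) \<notin> bad_event m0 (\<lambda>i. if i then m1 else m2)" for m0 m1 m2 z
  proof -
    define m where "m i = (if i then m1 else m2)" for i
    have m': "m0 \<in> M0" "m i \<in> M i" for i using m by (auto simp: m_def)
    have p: "(c, z) \<in> space (code_noise n labels)" using c z by (simp add: code_noise_def space_pair_measure)
    have nb': "(c, z) \<notin> bad_event m0 m" using nb unfolding m_def .
    have a: "(m0, m i, \<kappa> (\<not> i) (m (\<not> i))) \<in> hyps i" for i
      using m' by (auto simp: hyps_def)
    have "g True (?o1 m0 m1 m2 z) = ?lab (m0, m True, \<kappa> (\<not> True) (m (\<not> True)))"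
    proof (rule dec[OF _ a])
      show "?o1 m0 m1 m2 z \<in> space (PiM {..<n} (\<lambda>_. borel))" by (simp add: out1_def space_PiM)
      fix b' assume "b' \<in> hyps True" "?lab b' \<noteq> ?lab (m0, m True, \<kappa> (\<not> True) (m (\<not> True)))"
      then show "(\<Sum>t<n. (cmod (?o1 m0 m1 m2 z t - signal c True (m0, m True, \<kappa> (\<not> True) (m (\<not> True))) t))\<^sup>2)
          < (\<Sum>t<n. (cmod (?o1 m0 m1 m2 z t - signal c True b' t))\<^sup>2)"
        using m' by (intro min_distance_outside_bad_event[OF _ _ p nb']) (simp_all add: out1_def m_def noise_comp_def)
    qed
    moreover have "g False (?o2 m0 m1 m2 z) = ?lab (m0, m False, \<kappa> (\<not> False) (m (\<not> False)))"
    proof (rule dec[OF _ a])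
      show "?o2 m0 m1 m2 z \<in> space (PiM {..<n} (\<lambda>_. borel))" by (simp add: out2_def space_PiM)
      fix b' assume "b' \<in> hyps False" "?lab b' \<noteq> ?lab (m0, m False, \<kappa> (\<not> False) (m (\<not> False)))"
      then show "(\<Sum>t<n. (cmod (?o2 m0 m1 m2 z t - signal c False (m0, m False, \<kappa> (\<not> False) (m (\<not> False))) t))\<^sup>2)
          < (\<Sum>t<n. (cmod (?o2 m0 m1 m2 z t - signal c False b' t))\<^sup>2)"
        using m' by (intro min_distance_outside_bad_event[OF _ _ p nb']) (simp_all add: out2_def m_def noise_comp_def)
    qed
    ultimately show ?thesis by (simp add: m_def)
  qed
  have "err_prob (h True True) (h True False) (h False True) (h False False) n R0 R1 R2 (encoder c True) (encoder c False) (g True) (g False)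
    \<le> (\<Sum>m0\<in>M0. \<Sum>m1\<in>M True. \<Sum>m2\<in>M False.
        measure (noise n) {z \<in> space (noise n). (c, z) \<in> bad_event m0 (\<lambda>i. if i then m1 else m2)})
       / (real (card M0) * real (card (M True)) * real (card (M False)))"
    unfolding err_prob_def M[symmetric]
  proof (intro divide_right_mono sum_mono)
    fix m0 m1 m2 assume m: "m0 \<in> M0" "m1 \<in> M True" "m2 \<in> M False"
    let ?B = "bad_event m0 (\<lambda>i. if i then m1 else m2)"
    have B: "?B \<in> sets (PiM {..<n} (\<lambda>_. PiM labels (\<lambda>_. CN)) \<Otimes>\<^sub>M noise n)"
      using sets_bad_event(3)[of m0 "\<lambda>i. if i then m1 else m2"] m by (simp add: code_noise_def)
    have "{z \<in> space (noise n). (c, z) \<in> ?B} = Pair c -` ?B"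
      using sets.sets_into_space[OF B] by (auto simp: space_pair_measure)
    then have "{z \<in> space (noise n). (c, z) \<in> ?B} \<in> sets (noise n)"
      using sets_Pair1[OF B] by simp
    then show "measure (noise n) {z \<in> space (noise n). g True (?o1 m0 m1 m2 z) \<noteq> (m0, m1) \<or> g False (?o2 m0 m1 m2 z) \<noteq> (m0, m2)}
       \<le> measure (noise n) {z \<in> space (noise n). (c, z) \<in> ?B}"
      using good[OF m] by (intro Z.finite_measure_mono) auto
  qed simp
  also have "\<dots> \<le> \<epsilon>'"
    using sum_le card_msgs_pos[of n R0] card_msgs_pos[of n R1] card_msgs_pos[of n R2]
    by (simp add: M pos_divide_le_eq mult.commute)
  finally have "err_prob (h True True) (h True False) (h False True) (h False False) n R0 R1 R2 (encoder c True) (encoder c False) (g True) (g False) \<le> \<epsilon>'" .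
  moreover have "is_code n R0 R1 R2 (encoder c True) (encoder c False) (g True) (g False)"
    unfolding is_code_def using g M by (auto intro!: power_ok_encoder)
  ultimately show ?thesis by blast
qed

end

section \<open>Rate splitting\<close>

definition bin_size :: "nat \<Rightarrow> real \<Rightarrow> nat" where
  "bin_size n p = nat \<lceil>2 powr (real n * p)\<rceil>"

text \<open>Messages start at 1, hence \<open>m - 1\<close>. Consecutive blocks of
  \<open>bin_size n (p i)\<close> messages share an index, so \<open>p i\<close> is the private
  rate.\<close>

definition common_index :: "nat \<Rightarrow> (bool \<Rightarrow> real) \<Rightarrow> bool \<Rightarrow> nat \<Rightarrow> nat" where
  "common_index n p i m = (m - 1) div bin_size n (p i)"

text \<open>Rounding up a number that is at least 1 at most doubles it.\<close>

lemma bin_size_le: "0 \<le> p \<Longrightarrow> real (bin_size n p) \<le> 2 * 2 powr (real n * p)"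
proof -
  assume "0 \<le> p"
  then have "1 \<le> 2 powr (real n * p)" by (simp add: ge_one_powr_ge_zero)
  then show ?thesis unfolding bin_size_def by linarith
qed

lemma bin_size_ge: "2 powr (real n * p) \<le> real (bin_size n p)"
  unfolding bin_size_def by linarith

lemma bin_size_pos: "bin_size n p > 0"
  by (simp add: bin_size_def)

lemma card_msgs_bin_size: "card (msgs n R) = bin_size n R"
  by (simp add: card_msgs bin_size_def)

lemma msgs_zero: "msgs n 0 = {1}"
  by (auto simp: msgs_def)

lemma card_fiber_le:
  "card {m \<in> msgs n R. common_index n p i m = k} \<le> bin_size n (p i)"
proof -
  let ?N = "bin_size n (p i)"
  have "{m \<in> msgs n R. common_index n p i m = k} \<subseteq> {k * ?N + 1..k * ?N + ?N}"
  proof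
    fix m assume m: "m \<in> {m \<in> msgs n R. common_index n p i m = k}"
    then have "m \<ge> 1" by (auto simp: msgs_def)
    moreover have "k * ?N + (m - 1) mod ?N = m - 1"
      using m div_mult_mod_eq[of "m - 1" ?N] by (simp add: common_index_def)
    moreover have "(m - 1) mod ?N < ?N" using bin_size_pos[of n "p i"] by simp
    ultimately show "m \<in> {k * ?N + 1..k * ?N + ?N}" by auto
  qed
  from card_mono[OF _ this] show ?thesis by simp
qed

text \<open>The product of the two rounded-up sizes is at least the rounded-up product, so
  \<open>bin_size n (c i)\<close> blocks cover all messages.\<close>

lemma card_common_index_le:
  "card (common_index n p i ` msgs n (c i + p i)) \<le> bin_size n (c i)"
proof -
  have "common_index n p i ` msgs n (c i + p i) \<subseteq> {..<bin_size n (c i)}"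
  proof (rule image_subsetI)
    fix m assume m: "m \<in> msgs n (c i + p i)"
    have "2 powr (real n * (c i + p i)) \<le> real (bin_size n (c i)) * real (bin_size n (p i))"
      unfolding distrib_left powr_add by (intro mult_mono bin_size_ge) auto
    then have "\<lceil>2 powr (real n * (c i + p i))\<rceil> \<le> int (bin_size n (c i) * bin_size n (p i))"
      by (simp add: ceiling_le_iff)
    moreover have "1 \<le> m" "m \<le> nat \<lceil>2 powr (real n * (c i + p i))\<rceil>" using m by (auto simp: msgs_def)
    ultimately have "m - 1 < bin_size n (c i) * bin_size n (p i)" by linarith
    then show "common_index n p i m \<in> {..<bin_size n (c i)}"
      by (simp add: common_index_def div_less_iff_less_mult bin_size_pos)
  qed
  from card_mono[OF _ this] show ?thesis by simp
qed

text \<open>Exponential growth rate of the number of competitors of one type. \<open>R0\<close>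
  enters only when both common codewords differ, since otherwise \<open>m0\<close> is
  correct.\<close>

definition decoding_rate :: "real \<Rightarrow> (bool \<Rightarrow> real) \<Rightarrow> (bool \<Rightarrow> real) \<Rightarrow> bool \<Rightarrow> bool \<Rightarrow> bool \<Rightarrow> real" where
  "decoding_rate R0 c p i f g = p i + (if f then c i else 0) + (if g then c (\<not> i) else 0)
     + (if f \<and> g then R0 else 0)"

lemma err_prob_nonneg: "0 \<le> err_prob h11 h12 h21 h22 n R0 R1 R2 f1 f2 g1 g2"
  unfolding err_prob_def by (intro divide_nonneg_nonneg sum_nonneg) auto

locale rate_split =
  fixes h :: "bool \<Rightarrow> bool \<Rightarrow> complex" and \<beta> \<gamma> :: "bool \<Rightarrow> real"
    and R0 :: real and c p :: "bool \<Rightarrow> real"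
  assumes power: "\<beta> i \<ge> 0" "\<gamma> i \<ge> 0" "\<beta> i + \<gamma> i < 1"
    and rates: "R0 \<ge> 0" "c i \<ge> 0" "p i \<ge> 0"
begin

sublocale split_code h \<beta> \<gamma> n "msgs n R0" "\<lambda>i. msgs n (c i + p i)" "common_index n p" for n
  by standard (use power in auto)

text \<open>Competitors lie in a product of three sets, and rounding costs a factor 2 for each,
  giving 8. The second claim treats types of rate 0, for which the mutual information may vanish and
  a strict rate inequality fail: there only the true \<open>(m0, m)\<close> remains, and it is no
  competitor.\<close>

lemma card_competitors_le:
  assumes m: "m0 \<in> msgs n R0" "m \<in> msgs n (c i + p i)" "m' \<in> msgs n (c (\<not> i) + p (\<not> i))"
  shows "card (competitors n i f g (m0, m, common_index n p (\<not> i) m')) \<le> 8 * 2 powr (real n * decoding_rate R0 c p i f g)"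
    and "decoding_rate R0 c p i f g = 0 \<Longrightarrow> competitors n i f g (m0, m, common_index n p (\<not> i) m') = {}"
proof -
  let ?k = "common_index n p (\<not> i) m'"
  define A0 where "A0 = (if f \<and> g then msgs n R0 else {m0})"
  define A1 where "A1 = (if f then msgs n (c i + p i) else {m1 \<in> msgs n (c i + p i). common_index n p i m1 = common_index n p i m})"
  define A2 where "A2 = (if g then common_index n p (\<not> i) ` msgs n (c (\<not> i) + p (\<not> i)) else {?k})"
  define x0 where "x0 = (if f \<and> g then R0 else 0)"
  define x1 where "x1 = p i + (if f then c i else 0)"
  define x2 where "x2 = (if g then c (\<not> i) else 0)"
  have x: "x0 \<ge> 0" "x1 \<ge> 0" "x2 \<ge> 0" using rates by (auto simp: x0_def x1_def x2_def)
  have sub: "competitors n i f g (m0, m, ?k) \<subseteq> A0 \<times> A1 \<times> A2"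
    by (auto simp: hyps_def A0_def A1_def A2_def)
  have fin: "finite A0" "finite A1" "finite A2" by (auto simp: A0_def A1_def A2_def)
  have one: "1 \<le> bin_size n y" for y using bin_size_pos[of n y] by linarith
  have A0: "card A0 \<le> bin_size n x0"
    using one[of 0] by (auto simp: A0_def x0_def card_msgs_bin_size)
  have A1: "card A1 \<le> bin_size n x1"
    using card_fiber_le[of n "c i + p i" p i "common_index n p i m"]
    by (auto simp: A1_def x1_def card_msgs_bin_size add.commute)
  have A2: "card A2 \<le> bin_size n x2"
    using one[of 0] card_common_index_le[of n p "\<not> i" c] by (auto simp: A2_def x2_def)
  have "card (competitors n i f g (m0, m, ?k)) \<le> card (A0 \<times> A1 \<times> A2)"
    using fin by (intro card_mono sub) auto
  also have "\<dots> \<le> bin_size n x0 * (bin_size n x1 * bin_size n x2)"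
    unfolding card_cartesian_product by (intro mult_mono A0 A1 A2) auto
  finally have "real (card (competitors n i f g (m0, m, ?k))) \<le> real (bin_size n x0) * (real (bin_size n x1) * real (bin_size n x2))"
    by (metis of_nat_le_iff of_nat_mult)
  also have "\<dots> \<le> (2 * 2 powr (real n * x0)) * ((2 * 2 powr (real n * x1)) * (2 * 2 powr (real n * x2)))"
    by (intro mult_mono bin_size_le x) auto
  also have "\<dots> = 8 * 2 powr (real n * decoding_rate R0 c p i f g)"
  proof -
    have "decoding_rate R0 c p i f g = x0 + (x1 + x2)"
      by (simp add: decoding_rate_def x0_def x1_def x2_def)
    then show ?thesis by (simp add: distrib_left powr_add)
  qed
  finally show "card (competitors n i f g (m0, m, ?k)) \<le> 8 * 2 powr (real n * decoding_rate R0 c p i f g)" .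
  assume z: "decoding_rate R0 c p i f g = 0"
  have "x0 + x1 + x2 = 0" using z by (simp add: decoding_rate_def x0_def x1_def x2_def)
  then have x0: "x0 = 0" and x1: "x1 = 0" using x by linarith+
  have "A0 = {m0}" using m x0 by (auto simp: A0_def x0_def msgs_zero)
  moreover have "A1 = {m}"
  proof -
    have "card A1 \<le> 1" using A1 by (simp add: x1 bin_size_def)
    moreover have "m \<in> A1" using m by (simp add: A1_def)
    ultimately show ?thesis using fin(2)
      by (metis card_1_singletonE card_0_eq empty_iff le_SucE le_zero_eq One_nat_def singletonD)
  qed
  ultimately have "b \<in> {m0} \<times> {m} \<times> A2" if "b \<in> competitors n i f g (m0, m, ?k)" for b
    using that sub by auto
  then show "competitors n i f g (m0, m, ?k) = {}" by auto
qed

text \<open>The base \<open>\<rho>\<close> depends on the type alone, uniformly in the block length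
  and the messages. The constant 9 is 1 for the untypical true codeword plus 8 from the competitor
  count.\<close>

lemma closer_event_decay:
  assumes "decoding_rate R0 c p i f g = 0 \<or> decoding_rate R0 c p i f g < log 2 (1 + part_power h \<beta> \<gamma> i f g / noise_power h \<beta> i)"
  shows "\<exists>\<rho>>0. \<rho> < 1 \<and> (\<forall>n m0 m m'. m0 \<in> msgs n R0 \<longrightarrow> m \<in> msgs n (c i + p i) \<longrightarrow> m' \<in> msgs n (c (\<not> i) + p (\<not> i)) \<longrightarrow>
     emeasure (code_noise n (labels n)) (closer_event n i f g m0 m m') \<le> ennreal (9 * \<rho> ^ n))"
proof (cases "decoding_rate R0 c p i f g = 0")
  case True
  have "closer_event n i f g m0 m m' = {}"
    if "m0 \<in> msgs n R0" "m \<in> msgs n (c i + p i)" "m' \<in> msgs n (c (\<not> i) + p (\<not> i))" for n m0 m m'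
    unfolding closer_event_def card_competitors_le(2)[OF that True] by simp
  then show ?thesis by (intro exI[of _ "1/2"]) simp
next
  case False
  have N: "noise_power h \<beta> i \<ge> 1" and P: "part_power h \<beta> \<gamma> i f g \<ge> 0"
    using power by (auto simp: noise_power_def part_power_def)
  let ?N = "noise_power h \<beta> i" and ?P = "part_power h \<beta> \<gamma> i f g" and ?r = "decoding_rate R0 c p i f g"
  obtain s r' \<rho> where s: "0 < s" "s < 1" and \<rho>: "0 < \<rho>" "\<rho> < 1"
    and 1: "exp (s * r') / (1 - s\<^sup>2 * ?P / (?N + ?P)) \<le> \<rho>"
    and 2: "2 powr ?r * (?N / (?N + ?P) * exp (- r')) \<le> \<rho>"
    using exponent_decoding[of ?N ?P ?r] N P False assms by auto
  have pos: "0 \<le> exp (s * r') / (1 - s\<^sup>2 * ?P / (?N + ?P))"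
  proof -
    have "s\<^sup>2 * ?P \<le> 1 * ?P" using s P by (intro mult_right_mono) (auto simp: power_le_one)
    then show ?thesis using N P by simp
  qed
  have "emeasure (code_noise n (labels n)) (closer_event n i f g m0 m m') \<le> ennreal (9 * \<rho> ^ n)"
    if m: "m0 \<in> msgs n R0" "m \<in> msgs n (c i + p i)" "m' \<in> msgs n (c (\<not> i) + p (\<not> i))" for n m0 m m'
  proof -
    let ?K = "competitors n i f g (m0, m, common_index n p (\<not> i) m')"
    have "card ?K * (?N / (?N + ?P) * exp (- r')) ^ n \<le> (8 * 2 powr (real n * ?r)) * (?N / (?N + ?P) * exp (- r')) ^ n"
      using N P by (intro mult_right_mono card_competitors_le m) auto
    also have "\<dots> = 8 * (2 powr ?r * (?N / (?N + ?P) * exp (- r'))) ^ n"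
    proof -
      have "2 powr (real n * ?r) = (2 powr ?r) ^ n" by (simp add: powr_realpow[symmetric] powr_powr mult.commute)
      then show ?thesis by (simp only: power_mult_distrib mult.assoc)
    qed
    also have "\<dots> \<le> 8 * \<rho> ^ n"
      using N P by (intro mult_left_mono power_mono 2) auto
    finally have "card ?K * (?N / (?N + ?P) * exp (- r')) ^ n \<le> 8 * \<rho> ^ n" .
    moreover have "(exp (s * r') / (1 - s\<^sup>2 * ?P / (?N + ?P))) ^ n \<le> \<rho> ^ n"
      by (intro power_mono 1 pos)
    ultimately have "(exp (s * r') / (1 - s\<^sup>2 * ?P / (?N + ?P))) ^ n + card ?K * (?N / (?N + ?P) * exp (- r')) ^ n \<le> 9 * \<rho> ^ n"
      by simp
    from order_trans[OF emeasure_closer_event[OF m s] ennreal_leI[OF this]] show ?thesis .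
  qed
  then show ?thesis using \<rho> by blast
qed

lemma power_event_decay:
  "\<exists>\<rho>>0. \<rho> < 1 \<and> (\<forall>n m0 m. m0 \<in> msgs n R0 \<longrightarrow> m \<in> msgs n (c i + p i) \<longrightarrow>
     emeasure (code_noise n (labels n)) (power_event n i m0 m) \<le> ennreal (\<rho> ^ n))"
proof -
  obtain l \<rho> where l: "0 < l" "l * (\<beta> i + \<gamma> i) < 1" and \<rho>: "0 < \<rho>" "\<rho> < 1" "exp (- l) / (1 - l * (\<beta> i + \<gamma> i)) \<le> \<rho>"
    using exponent_power[of "\<beta> i + \<gamma> i"] power[of i] by auto
  have "emeasure (code_noise n (labels n)) (power_event n i m0 m) \<le> ennreal (\<rho> ^ n)"
    if m: "m0 \<in> msgs n R0" "m \<in> msgs n (c i + p i)" for n m0 m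
  proof -
    have "emeasure (code_noise n (labels n)) (power_event n i m0 m) \<le> ennreal ((exp (- l) / (1 - l * (\<beta> i + \<gamma> i))) ^ n)"
      unfolding power_event_def
      by (intro emeasure_power_violation finite_labels word_subset m word_power_eq[symmetric] l)
    also have "\<dots> \<le> ennreal (\<rho> ^ n)"
      using l \<rho> by (intro ennreal_leI power_mono) auto
    finally show ?thesis .
  qed
  then show ?thesis using \<rho> by blast
qed

theorem achievable_of_decoding_rates:
  assumes "\<And>i f g. decoding_rate R0 c p i f g = 0 \<or> decoding_rate R0 c p i f g < log 2 (1 + part_power h \<beta> \<gamma> i f g / noise_power h \<beta> i)"
  shows "achievable (h True True) (h True False) (h False True) (h False False) (R0, c True + p True, c False + p False)"
proof -
  define D1 where "D1 i f g \<rho> \<longleftrightarrow> 0 < \<rho> \<and> \<rho> < 1 \<and> (\<forall>n m0 m m'. m0 \<in> msgs n R0 \<longrightarrow> m \<in> msgs n (c i + p i) \<longrightarrow>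
       m' \<in> msgs n (c (\<not> i) + p (\<not> i)) \<longrightarrow>
       emeasure (code_noise n (labels n)) (closer_event n i f g m0 m m') \<le> ennreal (9 * \<rho> ^ n))" for i f g \<rho>
  \<comment> \<open>The decay bases are chosen as functions of the type so that they can be summed
    in a single error bound.\<close>
  define \<rho>1 where "\<rho>1 i f g = (SOME \<rho>. D1 i f g \<rho>)" for i f g
  have D1: "D1 i f g (\<rho>1 i f g)" for i f g
    unfolding \<rho>1_def by (rule someI_ex) (use closer_event_decay[OF assms] in \<open>simp only: D1_def\<close>)
  then have \<rho>1: "\<And>i f g. 0 < \<rho>1 i f g" "\<And>i f g. \<rho>1 i f g < 1"
    and closer: "\<And>i f g n m0 m m'. m0 \<in> msgs n R0 \<Longrightarrow> m \<in> msgs n (c i + p i) \<Longrightarrow> m' \<in> msgs n (c (\<not> i) + p (\<not> i)) \<Longrightarrow>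
     emeasure (code_noise n (labels n)) (closer_event n i f g m0 m m') \<le> ennreal (9 * \<rho>1 i f g ^ n)"
    unfolding D1_def by blast+
  define D2 where "D2 i \<rho> \<longleftrightarrow> 0 < \<rho> \<and> \<rho> < 1 \<and> (\<forall>n m0 m. m0 \<in> msgs n R0 \<longrightarrow> m \<in> msgs n (c i + p i) \<longrightarrow>
       emeasure (code_noise n (labels n)) (power_event n i m0 m) \<le> ennreal (\<rho> ^ n))" for i \<rho>
  define \<rho>2 where "\<rho>2 i = (SOME \<rho>. D2 i \<rho>)" for i
  have D2: "D2 i (\<rho>2 i)" for i
    unfolding \<rho>2_def by (rule someI_ex) (use power_event_decay in \<open>simp only: D2_def\<close>)
  then have \<rho>2: "\<And>i. 0 < \<rho>2 i" "\<And>i. \<rho>2 i < 1"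
    and viol: "\<And>i n m0 m. m0 \<in> msgs n R0 \<Longrightarrow> m \<in> msgs n (c i + p i) \<Longrightarrow>
     emeasure (code_noise n (labels n)) (power_event n i m0 m) \<le> ennreal (\<rho>2 i ^ n)"
    unfolding D2_def by blast+
  define \<epsilon> where "\<epsilon> n = (\<Sum>i\<in>UNIV. \<rho>2 i ^ n + (\<Sum>f\<in>UNIV. \<Sum>g\<in>UNIV. 9 * \<rho>1 i f g ^ n))" for n
  have \<epsilon>0: "0 \<le> \<epsilon> n" for n
    unfolding \<epsilon>_def using \<rho>1(1) \<rho>2(1) by (intro sum_nonneg add_nonneg_nonneg) (auto simp: less_imp_le)
  have "\<epsilon> \<longlonglongrightarrow> (\<Sum>i\<in>(UNIV :: bool set). 0 + (\<Sum>f\<in>(UNIV :: bool set). \<Sum>g\<in>(UNIV :: bool set). 9 * 0))"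
    unfolding \<epsilon>_def using \<rho>1 \<rho>2
    by (intro tendsto_sum tendsto_add tendsto_mult tendsto_const LIMSEQ_power_zero) (auto simp: less_imp_le abs_of_pos)
  then have \<epsilon>_lim: "\<epsilon> \<longlonglongrightarrow> 0" by simp
  \<comment> \<open>The vanishing extra term provides the strict slack required by
    \<open>exists_code\<close>.\<close>
  define \<epsilon>' where "\<epsilon>' n = \<epsilon> n + inverse (real (Suc n))" for n
  have \<epsilon>': "\<epsilon> n < \<epsilon>' n" for n by (simp add: \<epsilon>'_def)
  have \<epsilon>'_lim: "\<epsilon>' \<longlonglongrightarrow> 0"
    unfolding \<epsilon>'_def using tendsto_add[OF \<epsilon>_lim LIMSEQ_inverse_real_of_nat] by simp
  have bad: "emeasure (code_noise n (labels n)) (bad_event n m0 m) \<le> ennreal (\<epsilon> n)"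
    if m: "m0 \<in> msgs n R0" "\<And>i. m i \<in> msgs n (c i + p i)" for n m0 m
  proof -
    note sets = sets_bad_event(1,2)[OF m]
    have "emeasure (code_noise n (labels n)) (bad_event n m0 m)
      \<le> (\<Sum>i\<in>UNIV. emeasure (code_noise n (labels n)) (power_event n i m0 (m i) \<union> (\<Union>f. \<Union>g. closer_event n i f g m0 (m i) (m (\<not> i)))))"
      unfolding bad_event_def by (intro emeasure_subadditive_finite) (auto intro!: sets.Un sets.finite_UN sets)
    also have "\<dots> \<le> (\<Sum>i\<in>UNIV. emeasure (code_noise n (labels n)) (power_event n i m0 (m i))
         + emeasure (code_noise n (labels n)) (\<Union>f. \<Union>g. closer_event n i f g m0 (m i) (m (\<not> i))))"
      by (intro sum_mono emeasure_subadditive) (auto intro!: sets.finite_UN sets)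
    also have "\<dots> \<le> (\<Sum>i\<in>UNIV. emeasure (code_noise n (labels n)) (power_event n i m0 (m i))
         + (\<Sum>f\<in>UNIV. \<Sum>g\<in>UNIV. emeasure (code_noise n (labels n)) (closer_event n i f g m0 (m i) (m (\<not> i)))))"
    proof (intro sum_mono add_left_mono)
      fix i
      have "emeasure (code_noise n (labels n)) (\<Union>f. \<Union>g. closer_event n i f g m0 (m i) (m (\<not> i)))
         \<le> (\<Sum>f\<in>UNIV. emeasure (code_noise n (labels n)) (\<Union>g. closer_event n i f g m0 (m i) (m (\<not> i))))"
        by (intro emeasure_subadditive_finite) (auto intro!: sets.finite_UN sets)
      also have "\<dots> \<le> (\<Sum>f\<in>UNIV. \<Sum>g\<in>UNIV. emeasure (code_noise n (labels n)) (closer_event n i f g m0 (m i) (m (\<not> i))))"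
        by (intro sum_mono emeasure_subadditive_finite) (auto intro!: sets)
      finally show "emeasure (code_noise n (labels n)) (\<Union>f. \<Union>g. closer_event n i f g m0 (m i) (m (\<not> i))) \<le> \<dots>" .
    qed
    also have "\<dots> \<le> (\<Sum>i\<in>UNIV. ennreal (\<rho>2 i ^ n) + (\<Sum>f\<in>UNIV. \<Sum>g\<in>UNIV. ennreal (9 * \<rho>1 i f g ^ n)))"
      by (intro sum_mono add_mono viol closer m)
    also have "\<dots> = ennreal (\<epsilon> n)"
      unfolding \<epsilon>_def using \<rho>1(1) \<rho>2(1)
      by (simp add: UNIV_bool less_imp_le flip: ennreal_plus)
    finally show ?thesis .
  qed
  have "\<exists>F. \<forall>n. is_code n R0 (c True + p True) (c False + p False) (fst (F n)) (fst (snd (F n))) (fst (snd (snd (F n)))) (snd (snd (snd (F n))))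
     \<and> err_prob (h True True) (h True False) (h False True) (h False False) n R0 (c True + p True) (c False + p False)
        (fst (F n)) (fst (snd (F n))) (fst (snd (snd (F n)))) (snd (snd (snd (F n)))) \<le> \<epsilon>' n"
  proof (intro choice allI)
    fix n
    from exists_code[OF refl refl refl \<epsilon>0 \<epsilon>' bad, of n]
    show "\<exists>F. is_code n R0 (c True + p True) (c False + p False) (fst F) (fst (snd F)) (fst (snd (snd F))) (snd (snd (snd F)))
     \<and> err_prob (h True True) (h True False) (h False True) (h False False) n R0 (c True + p True) (c False + p False)
        (fst F) (fst (snd F)) (fst (snd (snd F))) (snd (snd (snd F))) \<le> \<epsilon>' n"
      by auto
  qed
  then obtain F where F: "\<And>n. is_code n R0 (c True + p True) (c False + p False) (fst (F n)) (fst (snd (F n))) (fst (snd (snd (F n)))) (snd (snd (snd (F n))))"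
    and err: "\<And>n. err_prob (h True True) (h True False) (h False True) (h False False) n R0 (c True + p True) (c False + p False)
        (fst (F n)) (fst (snd (F n))) (fst (snd (snd (F n)))) (snd (snd (snd (F n)))) \<le> \<epsilon>' n" by blast
  have "(\<lambda>n. err_prob (h True True) (h True False) (h False True) (h False False) n R0 (c True + p True) (c False + p False)
        (fst (F n)) (fst (snd (F n))) (fst (snd (snd (F n)))) (snd (snd (snd (F n))))) \<longlonglongrightarrow> 0"
    by (rule tendsto_sandwich[OF _ _ tendsto_const \<epsilon>'_lim]) (intro always_eventually allI err_prob_nonneg err)+
  then show ?thesis
    unfolding achievable_def prod.case using F
    by (intro exI[of _ "\<lambda>n. fst (F n)"] exI[of _ "\<lambda>n. fst (snd (F n))"]
        exI[of _ "\<lambda>n. fst (snd (snd (F n)))"] exI[of _ "\<lambda>n. snd (snd (snd (F n)))"] conjI allI)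
qed

end

section \<open>The inner region\<close>

text \<open>Concavity of the logarithm between 1 and \<open>1 + S\<close>.\<close>

lemma log2_scale_le:
  assumes "0 \<le> S" "0 \<le> t" "t \<le> 1"
  shows "t * log 2 (1 + S) \<le> log 2 (1 + t * S)"
proof -
  have "(1 - t) * ln 1 + t * ln (1 + S) \<le> ln ((1 - t) * 1 + t * (1 + S))"
    using concave_onD[OF ln_concave, of t 1 "1 + S"] assms by simp
  also have "(1 - t) * 1 + t * (1 + S) = 1 + t * S" by (simp add: algebra_simps)
  finally have "t * ln (1 + S) \<le> ln (1 + t * S)" by simp
  then have "t * ln (1 + S) / ln 2 \<le> ln (1 + t * S) / ln 2" by (intro divide_right_mono) auto
  then show ?thesis by (simp add: log_def)
qed

lemma part_power_scale: "part_power h (\<lambda>j. t * \<beta> j) (\<lambda>j. t * \<gamma> j) i f g = t * part_power h \<beta> \<gamma> i f g"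
  by (simp add: part_power_def algebra_simps)

text \<open>Shrinking all rates by \<open>1 - 2\<delta>\<close> but the powers only by \<open>1 - \<delta>\<close> makes every
  nontrivial rate constraint and the power constraint strict.\<close>
lemma split_in_capacity_region:
  fixes h :: "bool \<Rightarrow> bool \<Rightarrow> complex"
  assumes \<alpha>: "\<And>i. 0 \<le> \<alpha> i" "\<And>i. \<alpha> i \<le> 1"
    and nn: "R0 \<ge> 0" "\<And>i. c i \<ge> 0" "\<And>i. p i \<ge> 0"
    and le: "\<And>i f g. decoding_rate R0 c p i f g \<le> Cap (part_power h \<alpha> (\<lambda>j. 1 - \<alpha> j) i f g / noise_power h \<alpha> i)"
  shows "(R0, c True + p True, c False + p False)
     \<in> capacity_region (h True True) (h True False) (h False True) (h False False)"
proof -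
  have ach: "achievable (h True True) (h True False) (h False True) (h False False)
      (u * R0, u * c True + u * p True, u * c False + u * p False)"
    if u: "u = 1 - 2 * \<delta>" and \<delta>: "0 < \<delta>" "\<delta> \<le> 1/2" for u \<delta>
  proof -
    define t where "t = 1 - \<delta>"
    have t: "0 < t" "t < 1" "u < t" "0 \<le> u" using u \<delta> by (auto simp: t_def)
    define \<beta> where "\<beta> j = t * \<alpha> j" for j
    define \<gamma> where "\<gamma> j = t * (1 - \<alpha> j)" for j
    have \<beta>\<gamma>: "\<beta> i + \<gamma> i = t" for i by (simp add: \<beta>_def \<gamma>_def algebra_simps)
    interpret rate_split h \<beta> \<gamma> "u * R0" "\<lambda>i. u * c i" "\<lambda>i. u * p i"
      by standard (use t \<alpha> nn \<beta>\<gamma> in \<open>auto simp: \<beta>_def \<gamma>_def\<close>)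
    show ?thesis
    proof (rule achievable_of_decoding_rates)
      fix i f g
      let ?r = "decoding_rate R0 c p i f g"
      let ?S = "part_power h \<alpha> (\<lambda>j. 1 - \<alpha> j) i f g / noise_power h \<alpha> i"
      have r0: "?r \<ge> 0" using nn by (auto simp: decoding_rate_def)
      have ur: "decoding_rate (u * R0) (\<lambda>i. u * c i) (\<lambda>i. u * p i) i f g = u * ?r"
        by (simp add: decoding_rate_def algebra_simps)
      have P: "part_power h \<alpha> (\<lambda>j. 1 - \<alpha> j) i f g \<ge> 0" and N: "noise_power h \<alpha> i \<ge> 1"
        using \<alpha> by (auto simp: part_power_def noise_power_def)
      have Pt: "part_power h \<beta> \<gamma> i f g = t * part_power h \<alpha> (\<lambda>j. 1 - \<alpha> j) i f g"
        unfolding \<beta>_def \<gamma>_def by (rule part_power_scale)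
      have Nt: "noise_power h \<beta> i \<le> noise_power h \<alpha> i" "noise_power h \<beta> i \<ge> 1"
        using \<alpha> t by (auto simp: noise_power_def \<beta>_def intro!: mult_left_mono mult_left_le_one_le)
      \<comment> \<open>Shrinking the powers also shrinks the interference but not the unit noise,
        so the signal-to-noise ratio drops at most by the factor \<open>t\<close>.\<close>
      have S: "t * ?S \<le> part_power h \<beta> \<gamma> i f g / noise_power h \<beta> i"
        unfolding Pt times_divide_eq_right using P N Nt t by (intro divide_left_mono) auto
      show "decoding_rate (u * R0) (\<lambda>i. u * c i) (\<lambda>i. u * p i) i f g = 0 \<or>
        decoding_rate (u * R0) (\<lambda>i. u * c i) (\<lambda>i. u * p i) i f g < log 2 (1 + part_power h \<beta> \<gamma> i f g / noise_power h \<beta> i)"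
      proof (cases "?r = 0")
        case False
        then have "u * ?r < t * ?r" using r0 t by simp
        also have "\<dots> \<le> t * log 2 (1 + ?S)"
          using le[of i f g] t by (intro mult_left_mono) (auto simp: Cap_def)
        also have "\<dots> \<le> log 2 (1 + t * ?S)"
          using P N t by (intro log2_scale_le) auto
        also have "\<dots> \<le> log 2 (1 + part_power h \<beta> \<gamma> i f g / noise_power h \<beta> i)"
        proof -
          have "0 \<le> t * ?S" using P N t by simp
          then show ?thesis using S by simp
        qed
        finally show ?thesis unfolding ur by simp
      qed (simp add: ur)
    qed
  qed
  \<comment> \<open>Corresponds to \<open>\<delta> = 1 / (k + 2)\<close>, which is at most 1/2
    already for \<open>k = 0\<close>.\<close>
  define u where "u k = 1 - 2 * inverse (real (Suc (Suc k)))" for k :: nat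
  define X where "X k = (u k * R0, u k * c True + u k * p True, u k * c False + u k * p False)" for k
  have "u \<longlonglongrightarrow> 1 - 2 * 0"
    unfolding u_def
    by (intro tendsto_intros LIMSEQ_Suc[OF LIMSEQ_inverse_real_of_nat])
  then have u: "u \<longlonglongrightarrow> 1" by simp
  have "X \<longlonglongrightarrow> (1 * R0, 1 * c True + 1 * p True, 1 * c False + 1 * p False)"
    unfolding X_def by (intro tendsto_intros u)
  moreover have "achievable (h True True) (h True False) (h False True) (h False False) (X k)" for k
    unfolding X_def by (rule ach[where \<delta> = "inverse (real (Suc (Suc k)))"]) (auto simp: u_def field_simps)
  ultimately show ?thesis
    unfolding capacity_region_def closure_sequential by (intro exI[of _ X]) auto
qed

section \<open>Elimination of the private rates\<close>

text \<open>The witnesses are minimal: \<open>p1\<close> is the least value allowed by its own lower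
  bound and by that of \<open>p2\<close>, and \<open>p2\<close> is then the least value allowed by
  \<open>p1\<close>.\<close>

lemma fourier_motzkin_split:
  fixes L1 L2 U1 U2 a b :: real
  assumes "L1 \<le> U1" "L2 \<le> U2" "L1 - U2 \<le> a" "L2 - U1 \<le> b" "0 \<le> a + b"
  obtains p1 p2 where "L1 \<le> p1" "p1 \<le> U1" "L2 \<le> p2" "p2 \<le> U2" "p1 - p2 \<le> a" "p2 - p1 \<le> b"
proof
  show "L1 \<le> max L1 (L2 - b)" "max L1 (L2 - b) \<le> U1"
    "L2 \<le> max L2 (max L1 (L2 - b) - a)" "max L2 (max L1 (L2 - b) - a) \<le> U2"
    "max L1 (L2 - b) - max L2 (max L1 (L2 - b) - a) \<le> a" "max L2 (max L1 (L2 - b) - a) - max L1 (L2 - b) \<le> b"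
    using assms by linarith+
qed

lemma Cap_mono: "0 \<le> x \<Longrightarrow> x \<le> y \<Longrightarrow> Cap x \<le> Cap y"
  by (simp add: Cap_def)

lemma Cap_nonneg: "0 \<le> x \<Longrightarrow> 0 \<le> Cap x"
  by (simp add: Cap_def)

text \<open>\<open>x i\<close> is the private share of the power of user \<open>i\<close>, kept
  arbitrary in the unit interval here and instantiated with \<open>xmin\<close> at the end.\<close>

locale inner_region =
  fixes h :: "bool \<Rightarrow> bool \<Rightarrow> complex" and x :: "bool \<Rightarrow> real" and R0 :: real and R :: "bool \<Rightarrow> real"
  assumes x: "0 \<le> x i" "x i \<le> 1"
begin

definition a :: "bool \<Rightarrow> bool \<Rightarrow> real" where "a i j = (cmod (h i j))\<^sup>2"
definition N :: "bool \<Rightarrow> real" where "N i = 1 + a i (\<not> i) * x (\<not> i)"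
definition A :: "bool \<Rightarrow> real" where "A i = Cap (a i i * x i / N i)"
definition D :: "bool \<Rightarrow> real" where "D i = Cap (a i i / N i)"
definition E :: "bool \<Rightarrow> real" where "E i = Cap ((a i i * x i + a i (\<not> i) * (1 - x (\<not> i))) / N i)"
definition G :: "bool \<Rightarrow> real" where "G i = Cap ((a i i + a i (\<not> i) * (1 - x (\<not> i))) / N i)"

lemma a_nonneg: "a i j \<ge> 0" by (simp add: a_def)

lemma N_pos: "N i > 0" using x a_nonneg by (simp add: N_def add_pos_nonneg)

lemma A_nonneg: "A i \<ge> 0"
  unfolding A_def using x a_nonneg N_pos[of i] by (intro Cap_nonneg) auto

lemma A_le_E: "A i \<le> E i"
  unfolding A_def E_def using x a_nonneg N_pos[of i]
  by (intro Cap_mono divide_right_mono) (auto intro!: divide_nonneg_nonneg)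

text \<open>When the own rate exceeds \<open>A i + E (\<not> i)\<close>, no split of the rates is compatible with the
  power split \<open>x\<close>. Then user \<open>i\<close> transmits all its information privately and the other
  user all of its information publicly.\<close>
lemma all_private_in_capacity_region:
  assumes R: "R0 \<ge> 0" "\<And>j. R j \<ge> 0" and gt: "R i > A i + E (\<not> i)"
    and le: "R i \<le> D i" "R0 + 2 * R i + R (\<not> i) \<le> A i + G i + E (\<not> i)" "R0 + R i + R (\<not> i) \<le> A i + G (\<not> i)"
  shows "(R0, R True, R False) \<in> capacity_region (h True True) (h True False) (h False True) (h False False)"
proof -
  define \<alpha> where "\<alpha> j = (if j = i then 1 else x j)" for j
  define c where "c j = (if j = i then 0 else R j)" for j
  define p where "p j = (if j = i then R j else 0)" for j
  have sumG: "R0 + R i + R (\<not> i) \<le> G i" using gt le(2) by linarith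
  have "R0 + R (\<not> i) \<le> G (\<not> i) - E (\<not> i)" using gt le(3) by linarith
  \<comment> \<open>In \<open>G (\<not> i) - E (\<not> i)\<close> the normaliser
    \<open>N (\<not> i)\<close> cancels, and dropping the \<open>x\<close> term from the remaining
    denominator increases the ratio. The bound is the rate of user \<open>\<not> i\<close> when all
    of user \<open>i\<close> is treated as noise.\<close>
  also have "\<dots> \<le> Cap (a (\<not> i) (\<not> i) / (1 + a (\<not> i) i))"
  proof -
    have "G (\<not> i) = log 2 ((1 + a (\<not> i) (\<not> i) + a (\<not> i) i) / N (\<not> i))"
      unfolding G_def Cap_def using N_pos[of "\<not> i"]
      by (intro arg_cong[where f = "log 2"]) (simp add: N_def field_simps)
    moreover have "E (\<not> i) = log 2 ((1 + a (\<not> i) (\<not> i) * x (\<not> i) + a (\<not> i) i) / N (\<not> i))"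
      unfolding E_def Cap_def using N_pos[of "\<not> i"]
      by (intro arg_cong[where f = "log 2"]) (simp add: N_def field_simps)
    moreover have "Cap (a (\<not> i) (\<not> i) / (1 + a (\<not> i) i)) = log 2 ((1 + a (\<not> i) (\<not> i) + a (\<not> i) i) / (1 + a (\<not> i) i))"
      unfolding Cap_def using a_nonneg[of "\<not> i" i]
      by (intro arg_cong[where f = "log 2"]) (simp add: field_simps)
    moreover have "0 \<le> a (\<not> i) (\<not> i) * x (\<not> i)" using a_nonneg x by simp
    ultimately show ?thesis
      using a_nonneg[of "\<not> i" i] a_nonneg[of "\<not> i" "\<not> i"] N_pos[of "\<not> i"]
      by (simp add: log_divide add_nonneg_pos add_pos_nonneg)
  qed
  finally have sumo: "R0 + R (\<not> i) \<le> Cap (a (\<not> i) (\<not> i) / (1 + a (\<not> i) i))" .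
  have np: "noise_power h \<alpha> i = N i" "noise_power h \<alpha> (\<not> i) = 1 + a (\<not> i) i"
    by (simp_all add: noise_power_def \<alpha>_def N_def a_def)
  have pp: "part_power h \<alpha> (\<lambda>j. 1 - \<alpha> j) i f g = a i i + (if g then a i (\<not> i) * (1 - x (\<not> i)) else 0)"
    "part_power h \<alpha> (\<lambda>j. 1 - \<alpha> j) (\<not> i) f g = (if f then a (\<not> i) (\<not> i) else a (\<not> i) (\<not> i) * x (\<not> i))" for f g
    by (auto simp: part_power_def \<alpha>_def a_def algebra_simps)
  have "(R0, c True + p True, c False + p False)
     \<in> capacity_region (h True True) (h True False) (h False True) (h False False)"
  proof (rule split_in_capacity_region[where \<alpha> = \<alpha>])
    fix j f g
    consider "j = i" | "j = (\<not> i)" by blast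
    then show "decoding_rate R0 c p j f g \<le> Cap (part_power h \<alpha> (\<lambda>j. 1 - \<alpha> j) j f g / noise_power h \<alpha> j)"
    proof cases
      case 1
      then show ?thesis using sumG le(1) R R(2)[of "\<not> i"]
        by (auto simp: np pp decoding_rate_def c_def p_def G_def D_def)
    next
      case 2
      have "0 \<le> Cap (a (\<not> i) (\<not> i) * x (\<not> i) / (1 + a (\<not> i) i))"
        using a_nonneg x by (intro Cap_nonneg) (simp add: add_nonneg_nonneg)
      then show ?thesis using 2 sumo R R(2)[of "\<not> i"]
        by (auto simp: np pp decoding_rate_def c_def p_def)
    qed
  qed (use x R in \<open>auto simp: \<alpha>_def c_def p_def\<close>)
  moreover have "c j + p j = R j" for j by (simp add: c_def p_def)
  ultimately show ?thesis by simp
qed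

text \<open>Unless some rate exceeds \<open>A i + E (\<not> i)\<close>, the power split
  \<open>x\<close> works. With \<open>c i = R i - p i\<close>, the four types require at receiver
  \<open>i\<close> that \<open>p i \<le> A i\<close>, \<open>R i \<le> D i\<close>,
  \<open>p i + c (\<not> i) \<le> E i\<close> and \<open>R0 + R i + c (\<not> i) \<le> G i\<close>,
  a system of bounds on \<open>p True\<close>, \<open>p False\<close> and their difference.\<close>

lemma in_capacity_region:
  assumes R: "R0 \<ge> 0" "\<And>j. R j \<ge> 0"
    and G: "\<And>i. R0 + R i \<le> G i" and D: "\<And>i. R i \<le> D i" and EE: "R True + R False \<le> E True + E False"
    and AG: "\<And>i. R0 + R i + R (\<not> i) \<le> A i + G (\<not> i)"
    and AGE: "\<And>i. R0 + 2 * R i + R (\<not> i) \<le> A i + G i + E (\<not> i)"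
  shows "(R0, R True, R False) \<in> capacity_region (h True True) (h True False) (h False True) (h False False)"
proof (cases "\<exists>i. R i > A i + E (\<not> i)")
  case True
  then show ?thesis using all_private_in_capacity_region[OF R _ D AGE AG] by blast
next
  case False
  then have AE: "R i \<le> A i + E (\<not> i)" for i by (auto simp: not_less)
  note facts = AE[of True] AE[of False] G[of True] G[of False] EE AG[of True] AG[of False] AGE[of True] AGE[of False]
    A_nonneg[of True] A_nonneg[of False] A_le_E[of True] A_le_E[of False] R(1) R(2)[of True] R(2)[of False]
  \<comment> \<open>The lower bound on each private rate comes from the \<open>G\<close> constraint
    at the other receiver, the upper bound from \<open>A\<close> and \<open>c \<ge> 0\<close>, and
    the difference bounds from the \<open>E\<close> constraints.\<close>
  obtain p1 p2 where p: "max 0 (R0 + R True + R False - G False) \<le> p1" "p1 \<le> min (A True) (R True)"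
      "max 0 (R0 + R True + R False - G True) \<le> p2" "p2 \<le> min (A False) (R False)"
      "p1 - p2 \<le> E True - R False" "p2 - p1 \<le> E False - R True"
    by (rule fourier_motzkin_split[of "max 0 (R0 + R True + R False - G False)" "min (A True) (R True)"
        "max 0 (R0 + R True + R False - G True)" "min (A False) (R False)" "E True - R False" "E False - R True"])
      (use facts in \<open>auto simp: max_def min_def\<close>)
  define p where "p i = (if i then p1 else p2)" for i
  define c where "c i = R i - p i" for i
  have "(R0, c True + p True, c False + p False)
     \<in> capacity_region (h True True) (h True False) (h False True) (h False False)"
  proof (rule split_in_capacity_region[where \<alpha> = x])
    fix i f g
    have np: "noise_power h x i = N i" by (simp add: noise_power_def N_def a_def)
    have pp: "part_power h x (\<lambda>j. 1 - x j) i f g = (if f then a i i else a i i * x i) + (if g then a i (\<not> i) * (1 - x (\<not> i)) else 0)"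
      by (auto simp: part_power_def a_def algebra_simps)
    have "Cap (part_power h x (\<lambda>j. 1 - x j) i f g / noise_power h x i)
       = (if f then if g then G i else D i else if g then E i else A i)"
      by (simp add: np pp A_def D_def E_def G_def)
    then show "decoding_rate R0 c p i f g \<le> Cap (part_power h x (\<lambda>j. 1 - x j) i f g / noise_power h x i)"
      using p D[of True] D[of False] by (cases i) (auto simp: decoding_rate_def c_def p_def)
  qed (use x R p in \<open>auto simp: c_def p_def\<close>)
  then show ?thesis by (simp add: c_def)
qed

end

theorem theorem2:
  fixes h11 h12 h21 h22 :: complex
  shows "C_inner h11 h12 h21 h22 \<subseteq> capacity_region h11 h12 h21 h22"
proof clarify
  fix R0 R1 R2 assume R: "(R0, R1, R2) \<in> C_inner h11 h12 h21 h22"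
  define h where "h i j = (if i then (if j then h11 else h12) else (if j then h21 else h22))" for i j
  \<comment> \<open>The gain is that from user \<open>i\<close> to the unintended receiver: its
    private signal arrives there with power at most 1, the noise level.\<close>
  define x where "x i = xmin (h (\<not> i) i)" for i
  define R' where "R' i = (if i then R1 else R2)" for i
  interpret inner_region h x R0 R'
    by standard (auto simp: x_def xmin_def divide_le_eq_1)
  have G': "Cap ((1 + u + v) / (1 + v * w) - 1) = Cap ((u + v * (1 - w)) / (1 + v * w))" if "0 \<le> v * w" for u v w
    by (intro arg_cong[where f = Cap]) (use that in \<open>simp add: field_simps\<close>)
  have nn: "0 \<le> (cmod h12)\<^sup>2 * xmin h12" "0 \<le> (cmod h21)\<^sup>2 * xmin h21" by (auto simp: xmin_def)
  note R = R[unfolded C_inner_def Let_def G'[OF nn(1)] G'[OF nn(2)]]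
  have "(R0, R' True, R' False) \<in> capacity_region (h True True) (h True False) (h False True) (h False False)"
    by (rule in_capacity_region)
      (use R in \<open>auto simp: R'_def h_def x_def A_def D_def E_def G_def N_def a_def split: if_splits\<close>)
  then show "(R0, R1, R2) \<in> capacity_region h11 h12 h21 h22"
    by (simp add: h_def R'_def)
qed

end
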